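(* There is a countable structure whose degree spectrum is meagre and co-null.
   Context: The degree spectrum of a countable structure $\mathcal{M}$ is the collection of all Turing degrees which compute (the atomic diagram of) an isomorphic copy of $\mathcal{M}$ with universe a subset of $\omega$. A collection of Turing degrees is called null (co-null, meagre, co-meagre) if the set of all $X\in 2^\omega$ whose Turing degree belongs to the collection is null (co-null, meagre, co-meagre) in $2^\omega$, with respect to the uniform (fair-coin) measure and the usual topology. *)

theory Defs
  imports "HOL-Probability.Probability" "HOL-Library.Nat_Bijection"
begin

section \<open>Oracle computability\<close>

text \<open>
  Partial recursive functions relative to an oracle \<open>X\<close>, in Kleene's presentation.
  Subsets of \<open>\<omega>\<close> and elements of \<open>2\<^sup>\<omega>\<close> are identified with their characteristic functions
  \<open>nat \<Rightarrow> bool\<close>. Programs carry no arity; applying one to an argument list of the wrong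
  shape diverges.
\<close>

datatype prog =
    Zero
  | Succ
  | Query
  | Proj nat
  | Comp prog "prog list"
  | Rec prog prog
  | Mu prog

inductive evaluates :: "(nat \<Rightarrow> bool) \<Rightarrow> prog \<Rightarrow> nat list \<Rightarrow> nat \<Rightarrow> bool"
  for X :: "nat \<Rightarrow> bool"
where
  zero: "evaluates X Zero xs 0"
| succ: "evaluates X Succ [n] (Suc n)"
| query: "evaluates X Query [n] (of_bool (X n))"
| proj: "i < length xs \<Longrightarrow> evaluates X (Proj i) xs (xs ! i)"
| comp: "list_all2 (\<lambda>g y. evaluates X g xs y) gs ys \<Longrightarrow> evaluates X f ys z
    \<Longrightarrow> evaluates X (Comp f gs) xs z"
| rec_0: "evaluates X f xs y \<Longrightarrow> evaluates X (Rec f g) (0 # xs) y"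
| rec_Suc: "evaluates X (Rec f g) (n # xs) y \<Longrightarrow> evaluates X g (n # y # xs) z
    \<Longrightarrow> evaluates X (Rec f g) (Suc n # xs) z"
| mu: "evaluates X f (n # xs) 0 \<Longrightarrow> (\<forall>m<n. \<exists>y. evaluates X f (m # xs) (Suc y))
    \<Longrightarrow> evaluates X (Mu f) xs n"

definition computable_from :: "(nat \<Rightarrow> bool) \<Rightarrow> (nat \<Rightarrow> nat) \<Rightarrow> bool" where
  "computable_from X f \<longleftrightarrow> (\<exists>p. \<forall>n. evaluates X p [n] (f n))"

definition turing_reducible :: "(nat \<Rightarrow> bool) \<Rightarrow> (nat \<Rightarrow> bool) \<Rightarrow> bool" (infix "\<le>\<^sub>T" 50) where
  "A \<le>\<^sub>T X \<longleftrightarrow> computable_from X (\<lambda>n. of_bool (A n))"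

definition turing_degree :: "(nat \<Rightarrow> bool) \<Rightarrow> (nat \<Rightarrow> bool) set" where
  "turing_degree X = {Y. X \<le>\<^sub>T Y \<and> Y \<le>\<^sub>T X}"

section \<open>First-order structures in computable languages\<close>

text \<open>
  Symbols are natural numbers, and a language gives the arity of each of them (\<open>None\<close>: not a
  symbol). Constants are function symbols of arity \<open>0\<close>.
\<close>

record lang =
  rel_arity :: "nat \<Rightarrow> nat option"
  fun_arity :: "nat \<Rightarrow> nat option"

definition computable_lang :: "lang \<Rightarrow> bool" where
  "computable_lang L \<longleftrightarrow>
     computable_from (\<lambda>_. False) (\<lambda>n. case rel_arity L n of None \<Rightarrow> 0 | Some k \<Rightarrow> Suc k) \<and>
     computable_from (\<lambda>_. False) (\<lambda>n. case fun_arity L n of None \<Rightarrow> 0 | Some k \<Rightarrow> Suc k)"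

text \<open>
  The values of \<open>interp_rel\<close> and \<open>interp_fun\<close> at non-symbols, at tuples of the wrong length, or
  at tuples not from the universe are junk; no definition below depends on them.
\<close>

record 'a struc =
  universe :: "'a set"
  interp_rel :: "nat \<Rightarrow> 'a list \<Rightarrow> bool"
  interp_fun :: "nat \<Rightarrow> 'a list \<Rightarrow> 'a"

definition is_struc :: "lang \<Rightarrow> 'a struc \<Rightarrow> bool" where
  "is_struc L M \<longleftrightarrow> universe M \<noteq> {} \<and>
     (\<forall>f k xs. fun_arity L f = Some k \<and> length xs = k \<and> set xs \<subseteq> universe M
        \<longrightarrow> interp_fun M f xs \<in> universe M)"

definition isomorphism :: "lang \<Rightarrow> ('a \<Rightarrow> 'b) \<Rightarrow> 'a struc \<Rightarrow> 'b struc \<Rightarrow> bool" where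
  "isomorphism L h M N \<longleftrightarrow> bij_betw h (universe M) (universe N) \<and>
     (\<forall>R k xs. rel_arity L R = Some k \<and> length xs = k \<and> set xs \<subseteq> universe M
        \<longrightarrow> (interp_rel N R (map h xs) \<longleftrightarrow> interp_rel M R xs)) \<and>
     (\<forall>f k xs. fun_arity L f = Some k \<and> length xs = k \<and> set xs \<subseteq> universe M
        \<longrightarrow> interp_fun N f (map h xs) = h (interp_fun M f xs))"

definition isomorphic :: "lang \<Rightarrow> 'a struc \<Rightarrow> 'b struc \<Rightarrow> bool" where
  "isomorphic L M N \<longleftrightarrow> (\<exists>h. isomorphism L h M N)"

section \<open>The atomic diagram\<close>

text \<open>
  Closed terms and literals of the language expanded by a constant \<open>Elem a\<close> for each element \<open>a\<close>.
\<close>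

datatype 'a cterm = Elem 'a | App nat "'a cterm list"

datatype 'a atom = Eq "'a cterm" "'a cterm" | Rel nat "'a cterm list"

datatype 'a literal = Pos "'a atom" | Neg "'a atom"

fun wf_cterm :: "lang \<Rightarrow> 'a set \<Rightarrow> 'a cterm \<Rightarrow> bool" where
  "wf_cterm L A (Elem a) \<longleftrightarrow> a \<in> A"
| "wf_cterm L A (App f ts) \<longleftrightarrow> fun_arity L f = Some (length ts) \<and> (\<forall>t\<in>set ts. wf_cterm L A t)"

fun wf_atom :: "lang \<Rightarrow> 'a set \<Rightarrow> 'a atom \<Rightarrow> bool" where
  "wf_atom L A (Eq s t) \<longleftrightarrow> wf_cterm L A s \<and> wf_cterm L A t"
| "wf_atom L A (Rel R ts) \<longleftrightarrow> rel_arity L R = Some (length ts) \<and> (\<forall>t\<in>set ts. wf_cterm L A t)"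

fun wf_literal :: "lang \<Rightarrow> 'a set \<Rightarrow> 'a literal \<Rightarrow> bool" where
  "wf_literal L A (Pos \<phi>) \<longleftrightarrow> wf_atom L A \<phi>"
| "wf_literal L A (Neg \<phi>) \<longleftrightarrow> wf_atom L A \<phi>"

fun cterm_val :: "'a struc \<Rightarrow> 'a cterm \<Rightarrow> 'a" where
  "cterm_val M (Elem a) = a"
| "cterm_val M (App f ts) = interp_fun M f (map (cterm_val M) ts)"

fun atom_true :: "'a struc \<Rightarrow> 'a atom \<Rightarrow> bool" where
  "atom_true M (Eq s t) \<longleftrightarrow> cterm_val M s = cterm_val M t"
| "atom_true M (Rel R ts) \<longleftrightarrow> interp_rel M R (map (cterm_val M) ts)"

fun literal_true :: "'a struc \<Rightarrow> 'a literal \<Rightarrow> bool" where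
  "literal_true M (Pos \<phi>) \<longleftrightarrow> atom_true M \<phi>"
| "literal_true M (Neg \<phi>) \<longleftrightarrow> \<not> atom_true M \<phi>"

fun cterm_code :: "nat cterm \<Rightarrow> nat" where
  "cterm_code (Elem a) = sum_encode (Inl a)"
| "cterm_code (App f ts) = sum_encode (Inr (prod_encode (f, list_encode (map cterm_code ts))))"

fun atom_code :: "nat atom \<Rightarrow> nat" where
  "atom_code (Eq s t) = sum_encode (Inl (prod_encode (cterm_code s, cterm_code t)))"
| "atom_code (Rel R ts) = sum_encode (Inr (prod_encode (R, list_encode (map cterm_code ts))))"

fun literal_code :: "nat literal \<Rightarrow> nat" where
  "literal_code (Pos \<phi>) = sum_encode (Inl (atom_code \<phi>))"
| "literal_code (Neg \<phi>) = sum_encode (Inr (atom_code \<phi>))"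

text \<open>
  Since the literals \<open>Pos (Eq (Elem a) (Elem a))\<close> are included, the diagram also determines the
  universe.
\<close>

definition atomic_diagram :: "lang \<Rightarrow> nat struc \<Rightarrow> nat \<Rightarrow> bool" where
  "atomic_diagram L N n \<longleftrightarrow>
     (\<exists>l. wf_literal L (universe N) l \<and> literal_true N l \<and> n = literal_code l)"

section \<open>Degree spectra\<close>

definition computes_copy :: "lang \<Rightarrow> 'a struc \<Rightarrow> (nat \<Rightarrow> bool) \<Rightarrow> bool" where
  "computes_copy L M X \<longleftrightarrow>
     (\<exists>N :: nat struc. is_struc L N \<and> isomorphic L M N \<and> atomic_diagram L N \<le>\<^sub>T X)"

definition degree_spectrum :: "lang \<Rightarrow> 'a struc \<Rightarrow> (nat \<Rightarrow> bool) set set" where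
  "degree_spectrum L M = {turing_degree X | X. computes_copy L M X}"

section \<open>Measure and category\<close>

text \<open>
  The topology on \<open>nat \<Rightarrow> bool\<close> is the library's product topology (with \<open>bool\<close> discrete).
\<close>

definition coin_measure :: "(nat \<Rightarrow> bool) measure" where
  "coin_measure = Pi\<^sub>M UNIV (\<lambda>_. measure_pmf (bernoulli_pmf (1 / 2)))"

text \<open>The completion admits null sets that are not Borel.\<close>

definition null :: "(nat \<Rightarrow> bool) set \<Rightarrow> bool" where
  "null S \<longleftrightarrow> S \<in> null_sets (completion coin_measure)"

definition co_null :: "(nat \<Rightarrow> bool) set \<Rightarrow> bool" where
  "co_null S \<longleftrightarrow> null (- S)"

definition nowhere_dense :: "'a::topological_space set \<Rightarrow> bool" where
  "nowhere_dense S \<longleftrightarrow> interior (closure S) = {}"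

definition meagre :: "'a::topological_space set \<Rightarrow> bool" where
  "meagre S \<longleftrightarrow> (\<exists>\<F>. countable \<F> \<and> (\<forall>T\<in>\<F>. nowhere_dense T) \<and> S = \<Union>\<F>)"

definition degree_class_union :: "(nat \<Rightarrow> bool) set set \<Rightarrow> (nat \<Rightarrow> bool) set" where
  "degree_class_union \<C> = {X. turing_degree X \<in> \<C>}"

definition meagre_degrees :: "(nat \<Rightarrow> bool) set set \<Rightarrow> bool" where
  "meagre_degrees \<C> \<longleftrightarrow> meagre (degree_class_union \<C>)"

definition co_null_degrees :: "(nat \<Rightarrow> bool) set set \<Rightarrow> bool" where
  "co_null_degrees \<C> \<longleftrightarrow> co_null (degree_class_union \<C>)"

end

theory Submission
  imports Defs
begin

text \<open>
  For every Turing functional \<open>e\<close> and every finite string \<open>\<sigma>\<close> there is a board, a computable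
  process played in rounds against a structure that \<open>e\<close> builds from an extension of \<open>\<sigma>\<close>. On this
  board a player must make a move in \<open>\<omega>\<close> in every round. The process waits until the functional
  makes its move for some extension of the next string of a list in which every string recurs
  infinitely often, kills this move, and then waits until the hit player takes a mark; moves of
  past rounds are forgotten, marks are kept. The structure codes, for every board, the family of
  the positions of players; if the process stalls, the positions having the killed move but no
  mark are left out, and if it does not stall, the positions with infinitely many marks are.

  A random real, moving in round \<open>k\<close> according to \<open>k\<close> fresh bits, is hit with probability at most
  \<open>2\<^sup>-\<^sup>k\<close>, so by Borel--Cantelli it is hit finitely often on each board, and it enumerates exactly
  the required families: almost every real computes a copy of one and the same structure. On the
  other hand, if the process stalls, then \<open>e\<close> is wrong on a whole cone below \<open>\<sigma>\<close>; and if it does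
  not, then the reals below some extension of \<open>\<sigma>\<close> that take only finitely many marks form a
  meagre set.
\<close>

section \<open>Computable functions relative to an oracle\<close>

text \<open>Programs carry no arity, so the value is prescribed only on lists of length
  \<open>n\<close>. Closure rules for this notion let computability be proved along the syntax of an
  expression.\<close>

definition comput :: "(nat \<Rightarrow> bool) \<Rightarrow> nat \<Rightarrow> (nat list \<Rightarrow> nat) \<Rightarrow> bool" where
  "comput X n f \<longleftrightarrow> (\<exists>p. \<forall>xs. length xs = n \<longrightarrow> evaluates X p xs (f xs))"

definition decid :: "(nat \<Rightarrow> bool) \<Rightarrow> nat \<Rightarrow> (nat list \<Rightarrow> bool) \<Rightarrow> bool" where
  "decid X n P \<longleftrightarrow> comput X n (\<lambda>xs. of_bool (P xs))"

named_theorems comput_intros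

lemma comput_nth [comput_intros]: "i < n \<Longrightarrow> comput X n (\<lambda>xs. xs ! i)"
  unfolding comput_def by (metis evaluates.proj)

lemma comput_compose:
  assumes "comput X (length gs) F" and "\<forall>g\<in>set gs. comput X n g"
  shows "comput X n (\<lambda>xs. F (map (\<lambda>g. g xs) gs))"
proof -
  obtain p where p: "length ys = length gs \<Longrightarrow> evaluates X p ys (F ys)" for ys
    using assms(1) by (auto simp: comput_def)
  obtain q where q: "g \<in> set gs \<Longrightarrow> length xs = n \<Longrightarrow> evaluates X (q g) xs (g xs)" for g xs
    using assms(2) unfolding comput_def by metis
  have "evaluates X (Comp p (map q gs)) xs (F (map (\<lambda>g. g xs) gs))" if "length xs = n" for xs
    by (rule evaluates.comp[of _ _ _ "map (\<lambda>g. g xs) gs"])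
      (auto simp: list.rel_map intro!: list.rel_refl_strong q p that)
  then show ?thesis unfolding comput_def by blast
qed

lemma comput_app1:
  assumes "comput X 1 (\<lambda>xs. F (xs ! 0))" and "comput X n f"
  shows "comput X n (\<lambda>xs. F (f xs))"
  using comput_compose[of X "[f]" "\<lambda>xs. F (xs ! 0)" n] assms by simp

lemma comput_app2:
  assumes "comput X 2 (\<lambda>xs. F (xs ! 0) (xs ! 1))" and "comput X n f" and "comput X n g"
  shows "comput X n (\<lambda>xs. F (f xs) (g xs))"
  using comput_compose[of X "[f, g]" "\<lambda>xs. F (xs ! 0) (xs ! 1)" n] assms
  by (simp add: numeral_2_eq_2)

lemma comput_Suc [comput_intros]:
  assumes "comput X n f" shows "comput X n (\<lambda>xs. Suc (f xs))"
proof (rule comput_app1[OF _ assms])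
  have "evaluates X Succ xs (Suc (xs ! 0))" if "length xs = 1" for xs
    using that evaluates.succ by (cases xs) auto
  then show "comput X 1 (\<lambda>xs. Suc (xs ! 0))" unfolding comput_def by blast
qed

lemma comput_const [comput_intros]: "comput X n (\<lambda>_. c)"
proof (induction c)
  case 0
  then show ?case unfolding comput_def using evaluates.zero by blast
next
  case (Suc c)
  then show ?case by (rule comput_Suc)
qed

lemma comput_oracle [comput_intros]:
  assumes "comput X n f" shows "comput X n (\<lambda>xs. of_bool (X (f xs)))"
proof (rule comput_app1[OF _ assms, of "\<lambda>n. of_bool (X n)"])
  have "evaluates X Query xs (of_bool (X (xs ! 0)))" if "length xs = 1" for xs
    using that evaluates.query by (cases xs) auto
  then show "comput X 1 (\<lambda>xs. of_bool (X (xs ! 0)))" unfolding comput_def by blast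
qed

text \<open>One parameter is enough, since several can be packed into a pair.\<close>

lemma comput_rec_closed:
  assumes "comput X 1 (\<lambda>xs. b (xs ! 0))" and "comput X 3 (\<lambda>xs. h (xs ! 0) (xs ! 1) (xs ! 2))"
  shows "comput X 2 (\<lambda>xs. rec_nat (b (xs ! 1)) (\<lambda>i y. h i y (xs ! 1)) (xs ! 0))"
proof -
  obtain p where p: "evaluates X p [z] (b z)" for z
    using assms(1) unfolding comput_def
    by (metis One_nat_def length_Cons list.size(3) nth_Cons_0)
  obtain q where q: "evaluates X q [i, y, z] (h i y z)" for i y z
    using assms(2) unfolding comput_def
    by (metis One_nat_def length_Cons list.size(3) nth_Cons_0 nth_Cons_Suc numeral_2_eq_2 numeral_3_eq_3)
  have "evaluates X (Rec p q) [n, z] (rec_nat (b z) (\<lambda>i y. h i y z) n)" for n z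
  proof (induction n)
    case 0
    then show ?case using p by (simp add: evaluates.rec_0)
  next
    case (Suc n)
    then show ?case using q by (simp add: evaluates.rec_Suc)
  qed
  moreover have "\<exists>n z. xs = [n, z]" if "length xs = 2" for xs :: "nat list"
    using that by (auto simp: length_Suc_conv numeral_2_eq_2)
  ultimately show ?thesis
    unfolding comput_def by (metis One_nat_def nth_Cons_0 nth_Cons_Suc)
qed

lemma comput_rec:
  assumes "comput X 1 (\<lambda>xs. b (xs ! 0))" and "comput X 3 (\<lambda>xs. h (xs ! 0) (xs ! 1) (xs ! 2))"
    and "comput X n k" and "comput X n z"
  shows "comput X n (\<lambda>xs. rec_nat (b (z xs)) (\<lambda>i y. h i y (z xs)) (k xs))"
  by (rule comput_app2[OF comput_rec_closed[OF assms(1,2)] assms(3,4)])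

lemma comput_pred [comput_intros]:
  assumes "comput X n f" shows "comput X n (\<lambda>xs. f xs - 1)"
proof -
  have "comput X n (\<lambda>xs. rec_nat 0 (\<lambda>i y. i) (f xs))"
    by (rule comput_rec[where z = f]) (intro comput_intros assms; simp)+
  also have "(\<lambda>xs. rec_nat 0 (\<lambda>i y. i) (f xs)) = (\<lambda>xs. f xs - 1)"
  proof
    show "rec_nat 0 (\<lambda>i y. i) (f xs) = f xs - 1" for xs by (cases "f xs") auto
  qed
  finally show ?thesis .
qed

section \<open>Arithmetic and decidable predicates\<close>

lemma comput_add [comput_intros]:
  assumes "comput X n f" and "comput X n g" shows "comput X n (\<lambda>xs. f xs + g xs)"
proof -
  have "comput X n (\<lambda>xs. rec_nat (g xs) (\<lambda>i y. Suc y) (f xs))"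
    by (rule comput_rec) (intro comput_intros assms; simp)+
  moreover have "rec_nat a (\<lambda>i y. Suc y) k = k + a" for a k by (induction k) auto
  ultimately show ?thesis by simp
qed

lemma comput_minus [comput_intros]:
  assumes "comput X n f" and "comput X n g" shows "comput X n (\<lambda>xs. f xs - g xs)"
proof -
  have "comput X n (\<lambda>xs. rec_nat (f xs) (\<lambda>i y. y - 1) (g xs))"
    by (rule comput_rec) (intro comput_intros assms; simp)+
  moreover have "rec_nat a (\<lambda>i y. y - 1) k = a - k" for a k :: nat by (induction k) auto
  ultimately show ?thesis by simp
qed

lemma comput_mult [comput_intros]:
  assumes "comput X n f" and "comput X n g" shows "comput X n (\<lambda>xs. f xs * g xs)"
proof -
  have "comput X n (\<lambda>xs. rec_nat 0 (\<lambda>i y. y + g xs) (f xs))"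
    by (rule comput_rec) (intro comput_intros assms; simp)+
  moreover have "rec_nat 0 (\<lambda>i y. y + a) k = k * a" for a k :: nat by (induction k) auto
  ultimately show ?thesis by simp
qed

lemma decid_eq [comput_intros]:
  assumes "comput X n f" and "comput X n g" shows "decid X n (\<lambda>xs. f xs = g xs)"
proof -
  have "comput X n (\<lambda>xs. 1 - ((f xs - g xs) + (g xs - f xs)))"
    by (intro comput_intros assms)
  moreover have "1 - ((a - b) + (b - a)) = of_bool (a = b)" for a b :: nat by auto
  ultimately show ?thesis by (simp add: decid_def)
qed

lemma decid_less [comput_intros]:
  assumes "comput X n f" and "comput X n g" shows "decid X n (\<lambda>xs. f xs < g xs)"
proof -
  have "comput X n (\<lambda>xs. 1 - (1 - (g xs - f xs)))"
    by (intro comput_intros assms)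
  moreover have "1 - (1 - (b - a)) = of_bool (a < b)" for a b :: nat by auto
  ultimately show ?thesis by (simp add: decid_def)
qed

lemma decid_not [comput_intros]:
  assumes "decid X n P" shows "decid X n (\<lambda>xs. \<not> P xs)"
proof -
  have "comput X n (\<lambda>xs. 1 - of_bool (P xs))"
    using assms unfolding decid_def by (intro comput_intros)
  moreover have "1 - of_bool p = (of_bool (\<not> p) :: nat)" for p by auto
  ultimately show ?thesis by (simp add: decid_def)
qed

lemma decid_conj [comput_intros]:
  assumes "decid X n P" and "decid X n Q" shows "decid X n (\<lambda>xs. P xs \<and> Q xs)"
proof -
  have "comput X n (\<lambda>xs. of_bool (P xs) * of_bool (Q xs))"
    using assms unfolding decid_def by (intro comput_intros)
  then show ?thesis by (simp add: decid_def of_bool_conj)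
qed

lemma decid_disj [comput_intros]:
  assumes "decid X n P" and "decid X n Q" shows "decid X n (\<lambda>xs. P xs \<or> Q xs)"
  using decid_not[OF decid_conj[OF decid_not[OF assms(1)] decid_not[OF assms(2)]]] by simp

lemma decid_le [comput_intros]:
  assumes "comput X n f" and "comput X n g" shows "decid X n (\<lambda>xs. f xs \<le> g xs)"
  using decid_not[OF decid_less[OF assms(2,1)]] by (simp add: not_less)

lemma comput_of_bool [comput_intros]:
  "decid X n P \<Longrightarrow> comput X n (\<lambda>xs. of_bool (P xs))"
  by (simp add: decid_def)

lemma comput_if [comput_intros]:
  assumes "decid X n P" and "comput X n f" and "comput X n g"
  shows "comput X n (\<lambda>xs. if P xs then f xs else g xs)"
proof -
  have "comput X n (\<lambda>xs. of_bool (P xs) * f xs + (1 - of_bool (P xs)) * g xs)"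
    using assms by (intro comput_intros)
  moreover have "of_bool p * a + (1 - of_bool p) * b = (if p then a else b)" for p and a b :: nat
    by auto
  ultimately show ?thesis by simp
qed

lemma decid_if [comput_intros]:
  assumes "decid X n P" and "decid X n Q" and "decid X n R"
  shows "decid X n (\<lambda>xs. if P xs then Q xs else R xs)"
  using comput_if[of X n P "\<lambda>xs. of_bool (Q xs)" "\<lambda>xs. of_bool (R xs)"] assms
  unfolding decid_def by (simp add: if_distrib)

lemma comput_max [comput_intros]:
  "comput X n f \<Longrightarrow> comput X n g \<Longrightarrow> comput X n (\<lambda>xs. max (f xs) (g xs))"
  unfolding max_def by (intro comput_intros)

lemma comput_div2 [comput_intros]:
  assumes "comput X n f" shows "comput X n (\<lambda>xs. f xs div 2)"
proof -
  \<comment> \<open>The step from \<open>y\<close> to \<open>i - y\<close> turns the floor of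
    \<open>i / 2\<close> into its ceiling, which is the floor of \<open>(i + 1) / 2\<close>.\<close>
  have "comput X n (\<lambda>xs. rec_nat 0 (\<lambda>i y. i - y) (f xs))"
    by (rule comput_rec[where z = f]) (intro comput_intros assms; simp)+
  moreover have "rec_nat 0 (\<lambda>i y. i - y) k = k div 2" for k :: nat
    by (induction k) auto
  ultimately show ?thesis by simp
qed

lemma decid_even [comput_intros]:
  assumes "comput X n f" shows "decid X n (\<lambda>xs. even (f xs))"
proof -
  have "decid X n (\<lambda>xs. f xs = 2 * (f xs div 2))"
    by (intro comput_intros assms)
  moreover have "(k = 2 * (k div 2)) = even k" for k :: nat by presburger
  ultimately show ?thesis by simp
qed

lemma comput_power2 [comput_intros]:
  assumes "comput X n f" shows "comput X n (\<lambda>xs. (2::nat) ^ f xs)"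
proof -
  have "comput X n (\<lambda>xs. rec_nat 1 (\<lambda>i y. y + y) (f xs))"
    by (rule comput_rec[where z = f]) (intro comput_intros assms; simp)+
  moreover have "rec_nat 1 (\<lambda>i y. y + y) k = (2::nat) ^ k" for k by (induction k) auto
  ultimately show ?thesis by simp
qed

lemma comput_div_power2 [comput_intros]:
  assumes "comput X n f" and "comput X n g" shows "comput X n (\<lambda>xs. f xs div 2 ^ g xs)"
proof -
  have "comput X n (\<lambda>xs. rec_nat (f xs) (\<lambda>i y. y div 2) (g xs))"
    by (rule comput_rec) (intro comput_intros assms; simp)+
  moreover have "rec_nat a (\<lambda>i y. y div 2) k = a div 2 ^ k" for a k :: nat
    by (induction k) (auto simp: mult.commute simp flip: div_mult2_eq)
  ultimately show ?thesis by simp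
qed

lemma comput_mod_power2 [comput_intros]:
  assumes "comput X n f" and "comput X n g" shows "comput X n (\<lambda>xs. f xs mod 2 ^ g xs)"
proof -
  have "comput X n (\<lambda>xs. f xs - 2 ^ g xs * (f xs div 2 ^ g xs))"
    by (intro comput_intros assms)
  then show ?thesis by (simp add: minus_mult_div_eq_mod)
qed

lemma decid_bit [comput_intros]:
  "comput X n f \<Longrightarrow> comput X n g \<Longrightarrow> decid X n (\<lambda>xs. bit (f xs) (g xs))"
  unfolding bit_iff_odd by (intro comput_intros)

section \<open>Codes of pairs and lists\<close>

lemma comput_prod_encode [comput_intros]:
  assumes "comput X n f" and "comput X n g"
  shows "comput X n (\<lambda>xs. prod_encode (f xs, g xs))"
  unfolding prod_encode_def triangle_def by (simp add: algebra_simps) (intro comput_intros assms)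

text \<open>The index of the diagonal through the pair that \<open>n\<close> encodes.\<close>
definition diag_index :: "nat \<Rightarrow> nat" where
  "diag_index n = rec_nat 0 (\<lambda>i y. if triangle (Suc y) \<le> Suc i then Suc y else y) n"

text \<open>The recursion moves on exactly when \<open>n\<close> reaches the first entry of the next
  diagonal. As \<open>triangle\<close> is increasing, the bounds pin the index down, and decoding
  becomes primitive recursive.\<close>

lemma diag_index_bounds:
  "triangle (diag_index n) \<le> n \<and> n < triangle (Suc (diag_index n))"
  by (induction n) (auto simp: diag_index_def)

lemma diag_index_prod_encode: "diag_index (prod_encode (a, b)) = a + b"
proof -
  have mono: "triangle i \<le> triangle j" if "i \<le> j" for i j
    using that by (rule lift_Suc_mono_le[rotated]) simp
  have "triangle (a + b) \<le> prod_encode (a, b)" "prod_encode (a, b) < triangle (Suc (a + b))"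
    by (auto simp: prod_encode_def)
  then show ?thesis
    using diag_index_bounds[of "prod_encode (a, b)"]
      mono[of "Suc (a + b)" "diag_index (prod_encode (a, b))"]
      mono[of "Suc (diag_index (prod_encode (a, b)))" "a + b"]
    by linarith
qed

lemma comput_diag_index: 
  assumes "comput X n f" shows "comput X n (\<lambda>xs. diag_index (f xs))"
  unfolding diag_index_def triangle_def
  by (rule comput_rec[where z = f]) (intro comput_intros assms; simp)+

lemma prod_decode_diag_index:
  "fst (prod_decode n) = n - triangle (diag_index n)"
  "snd (prod_decode n) = diag_index n - (n - triangle (diag_index n))"
proof -
  obtain a b where "prod_decode n = (a, b)" by force
  then have "n = prod_encode (a, b)" by (metis prod_decode_inverse)
  then show "fst (prod_decode n) = n - triangle (diag_index n)"
    "snd (prod_decode n) = diag_index n - (n - triangle (diag_index n))"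
    by (simp_all add: diag_index_prod_encode) (simp_all add: prod_encode_def)
qed

lemma comput_prod_decode [comput_intros]:
  assumes "comput X n f"
  shows "comput X n (\<lambda>xs. fst (prod_decode (f xs)))" "comput X n (\<lambda>xs. snd (prod_decode (f xs)))"
  unfolding prod_decode_diag_index triangle_def
  by (intro comput_intros comput_diag_index assms)+

text \<open>\<open>list_encode\<close> sends the empty list to \<open>0\<close> and any other to the
  successor of the pair of its head and coded tail, whence the \<open>- 1\<close>.\<close>

definition code_hd :: "nat \<Rightarrow> nat" where
  "code_hd l = fst (prod_decode (l - 1))"

definition code_tl :: "nat \<Rightarrow> nat" where
  "code_tl l = snd (prod_decode (l - 1))"

definition code_nth :: "nat \<Rightarrow> nat \<Rightarrow> nat" where
  "code_nth l i = code_hd (rec_nat l (\<lambda>_. code_tl) i)"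

lemma code_hd_Cons [simp]: "code_hd (Suc (prod_encode (a, l))) = a"
  and code_tl_Cons [simp]: "code_tl (Suc (prod_encode (a, l))) = l"
  by (simp_all add: code_hd_def code_tl_def)

lemma code_nth_list_encode: "i < length xs \<Longrightarrow> code_nth (list_encode xs) i = xs ! i"
proof -
  have "i \<le> length xs \<Longrightarrow> rec_nat (list_encode xs) (\<lambda>_. code_tl) i = list_encode (drop i xs)"
  proof (induction i)
    case (Suc i)
    then have "drop i xs = xs ! i # drop (Suc i) xs" by (simp add: Cons_nth_drop_Suc)
    then show ?case using Suc by simp
  qed simp
  moreover assume "i < length xs"
  ultimately show ?thesis by (simp add: code_nth_def flip: Cons_nth_drop_Suc)
qed

lemma comput_code_hd [comput_intros]:
  "comput X n f \<Longrightarrow> comput X n (\<lambda>xs. code_hd (f xs))"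
  unfolding code_hd_def by (intro comput_intros)

lemma comput_code_tl [comput_intros]:
  "comput X n f \<Longrightarrow> comput X n (\<lambda>xs. code_tl (f xs))"
  unfolding code_tl_def by (intro comput_intros)

lemma comput_code_nth [comput_intros]:
  assumes "comput X n f" and "comput X n g" shows "comput X n (\<lambda>xs. code_nth (f xs) (g xs))"
  unfolding code_nth_def
  by (intro comput_code_hd comput_rec) (intro comput_intros assms; simp)+

section \<open>Relative computability is transitive\<close>

fun subst_query :: "prog \<Rightarrow> prog \<Rightarrow> prog" where
  "subst_query q Query = q"
| "subst_query q (Comp f gs) = Comp (subst_query q f) (map (subst_query q) gs)"
| "subst_query q (Rec f g) = Rec (subst_query q f) (subst_query q g)"
| "subst_query q (Mu f) = Mu (subst_query q f)"
| "subst_query q p = p"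

text \<open>Every query to \<open>Y\<close> is replaced by a run of \<open>q\<close>, which computes
  \<open>Y\<close> from \<open>X\<close>; this makes Turing reducibility transitive.\<close>

lemma evaluates_subst_query:
  assumes "evaluates Y p xs v" and q: "\<And>n. evaluates X q [n] (of_bool (Y n))"
  shows "evaluates X (subst_query q p) xs v"
  using assms(1)
proof (induction rule: evaluates.induct)
  case (comp xs gs ys f z)
  have "list_all2 (\<lambda>g y. evaluates X g xs y) (map (subst_query q) gs) ys"
    using comp(1) by (auto simp: list.rel_map elim!: list_all2_mono)
  then show ?case using comp by (auto intro: evaluates.comp)
next
  case (query n)
  show ?case by (simp only: subst_query.simps q)
qed (auto intro: evaluates.intros)

lemma turing_reducible_trans: "A \<le>\<^sub>T Y \<Longrightarrow> Y \<le>\<^sub>T X \<Longrightarrow> A \<le>\<^sub>T X"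
  unfolding turing_reducible_def computable_from_def by (metis evaluates_subst_query)

lemma turing_reducible_refl: "A \<le>\<^sub>T A"
  unfolding turing_reducible_def computable_from_def using evaluates.query by blast

section \<open>A universal stack machine\<close>

abbreviation pr :: "nat \<Rightarrow> nat \<Rightarrow> nat" where "pr a b \<equiv> prod_encode (a, b)"
abbreviation p1 :: "nat \<Rightarrow> nat" where "p1 n \<equiv> fst (prod_decode n)"
abbreviation p2 :: "nat \<Rightarrow> nat" where "p2 n \<equiv> snd (prod_decode n)"
abbreviation code_Cons :: "nat \<Rightarrow> nat \<Rightarrow> nat" where "code_Cons a l \<equiv> Suc (pr a l)"

text \<open>
  The arguments of a composition are stored in reverse order, so that the list of their values
  comes out in the right one.
\<close>
fun prog_code :: "prog \<Rightarrow> nat" where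
  "prog_code Zero = pr 0 0"
| "prog_code Succ = pr 1 0"
| "prog_code Query = pr 2 0"
| "prog_code (Proj i) = pr 3 i"
| "prog_code (Comp f gs) = pr 4 (pr (prog_code f) (list_encode (rev (map prog_code gs))))"
| "prog_code (Rec f g) = pr 5 (pr (prog_code f) (prog_code g))"
| "prog_code (Mu f) = pr 6 (prog_code f)"

text \<open>
  A state either evaluates a program on an argument list or returns a value, in both cases with
  a stack of pending frames. The state \<open>0\<close> is the failure reached by a query the oracle does not
  answer; an oracle answers a query by \<open>Suc\<close> of the bit, and by \<open>0\<close> if it is undefined.
\<close>
definition ev :: "nat \<Rightarrow> nat \<Rightarrow> nat \<Rightarrow> nat" where
  "ev p xs K = pr 1 (pr p (pr xs K))"

definition rt :: "nat \<Rightarrow> nat \<Rightarrow> nat" where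
  "rt v K = pr 2 (pr v K)"

text \<open>A frame is a tagged tuple. Tag \<open>0\<close> keeps the function of a composition, its
  remaining arguments, the input and the values found so far; tag \<open>1\<close> the step program
  of a recursion with its input; tag \<open>2\<close> the body of a minimisation with the input just
  tried.\<close>

definition next_arg :: "nat \<Rightarrow> nat \<Rightarrow> nat \<Rightarrow> nat \<Rightarrow> nat \<Rightarrow> nat" where
  "next_arg f gs xs ys K = (if gs = 0 then ev f ys K
     else ev (code_hd gs) xs (code_Cons (pr 0 (pr f (pr (code_tl gs) (pr xs ys)))) K))"

definition eval_step :: "(nat \<Rightarrow> nat) \<Rightarrow> nat \<Rightarrow> nat \<Rightarrow> nat \<Rightarrow> nat" where
  "eval_step orc p xs K =
    (if p1 p = 0 then rt 0 K
     else if p1 p = 1 then rt (Suc (code_hd xs)) K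
     else if p1 p = 2 then (if orc (code_hd xs) = 0 then 0 else rt (orc (code_hd xs) - 1) K)
     else if p1 p = 3 then rt (code_nth xs (p2 p)) K
     else if p1 p = 4 then next_arg (p1 (p2 p)) (p2 (p2 p)) xs 0 K
     else if p1 p = 5 then
       (if code_hd xs = 0 then ev (p1 (p2 p)) (code_tl xs) K
        else ev p (code_Cons (code_hd xs - 1) (code_tl xs))
               (code_Cons (pr 1 (pr (p2 (p2 p)) (code_Cons (code_hd xs - 1) (code_tl xs)))) K))
     else ev (p2 p) (code_Cons 0 xs) (code_Cons (pr 2 (pr (p2 p) (code_Cons 0 xs))) K))"

definition ret_step :: "nat \<Rightarrow> nat \<Rightarrow> nat \<Rightarrow> nat \<Rightarrow> nat" where
  "ret_step v t a K =
    (if t = 0 then next_arg (p1 a) (p1 (p2 a)) (p1 (p2 (p2 a))) (code_Cons v (p2 (p2 (p2 a)))) K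
     else if t = 1 then ev (p1 a) (code_Cons (code_hd (p2 a)) (code_Cons v (code_tl (p2 a)))) K
     else if v = 0 then rt (code_hd (p2 a)) K
     else ev (p1 a) (code_Cons (Suc (code_hd (p2 a))) (code_tl (p2 a)))
       (code_Cons (pr 2 (pr (p1 a) (code_Cons (Suc (code_hd (p2 a))) (code_tl (p2 a))))) K))"

text \<open>\<open>rt v 0\<close> is a fixed point and \<open>0\<close> is absorbing, so runs of
  different lengths can be compared.\<close>

definition mstep :: "(nat \<Rightarrow> nat) \<Rightarrow> nat \<Rightarrow> nat" where
  "mstep orc st =
    (if p1 st = 1 then eval_step orc (p1 (p2 st)) (p1 (p2 (p2 st))) (p2 (p2 (p2 st)))
     else if p1 st = 2 then
       (if p2 (p2 st) = 0 then st
        else ret_step (p1 (p2 st)) (p1 (code_hd (p2 (p2 st)))) (p2 (code_hd (p2 (p2 st))))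
          (code_tl (p2 (p2 st))))
     else 0)"

definition mrun :: "(nat \<Rightarrow> nat) \<Rightarrow> nat \<Rightarrow> nat \<Rightarrow> nat" where
  "mrun orc st s = rec_nat st (\<lambda>_. mstep orc) s"

section \<open>Simulation of evaluations by the machine\<close>

lemma mrun_0 [simp]: "mrun orc st 0 = st"
  and mrun_Suc [simp]: "mrun orc st (Suc s) = mstep orc (mrun orc st s)"
  by (simp_all add: mrun_def)

lemma mrun_add: "mrun orc st (s + t) = mrun orc (mrun orc st s) t"
  by (induction t) auto

lemma mrun_Suc_shift: "mrun orc st (Suc s) = mrun orc (mstep orc st) s"
  using mrun_add[of orc st 1 s] by simp

definition reaches :: "(nat \<Rightarrow> nat) \<Rightarrow> nat \<Rightarrow> nat \<Rightarrow> bool" where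
  "reaches orc st st' \<longleftrightarrow> (\<exists>s. mrun orc st s = st')"

lemma reaches_refl: "reaches orc st st"
  unfolding reaches_def by (metis mrun_0)

lemma reaches_trans: "reaches orc a b \<Longrightarrow> reaches orc b c \<Longrightarrow> reaches orc a c"
  unfolding reaches_def by (metis mrun_add)

lemma reaches_step: "reaches orc (mstep orc a) b \<Longrightarrow> reaches orc a b"
  unfolding reaches_def by (metis mrun_Suc_shift)

definition total_oracle :: "(nat \<Rightarrow> bool) \<Rightarrow> nat \<Rightarrow> nat" where
  "total_oracle X i = Suc (of_bool (X i))"

lemma mstep_ev: "mstep orc (ev p xs K) = eval_step orc p xs K"
  by (simp add: mstep_def ev_def)

lemma mstep_rt: "mstep orc (rt v (code_Cons fr K)) = ret_step v (p1 fr) (p2 fr) K"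
  by (simp add: mstep_def rt_def)

text \<open>The values pile up on \<open>acc\<close> in reverse, hence the \<open>rev\<close> and
  the generalisation over \<open>acc\<close>.\<close>

lemma reaches_next_arg:
  assumes "list_all2 (\<lambda>g y. \<forall>K. reaches orc (ev g xs K) (rt y K)) gs ys"
  shows "reaches orc (next_arg f (list_encode gs) xs (list_encode acc) K)
    (ev f (list_encode (rev ys @ acc)) K)"
  using assms
proof (induction arbitrary: acc rule: list_all2_induct)
  case Nil
  then show ?case by (simp add: next_arg_def reaches_refl)
next
  case (Cons g gs y ys)
  let ?K = "code_Cons (pr 0 (pr f (pr (list_encode gs) (pr xs (list_encode acc))))) K"
  have "reaches orc (next_arg f (list_encode (g # gs)) xs (list_encode acc) K) (rt y ?K)"
    using Cons(1) by (simp add: next_arg_def)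
  moreover have "mstep orc (rt y ?K) = next_arg f (list_encode gs) xs (list_encode (y # acc)) K"
    by (simp add: mstep_rt ret_step_def)
  then have "reaches orc (mstep orc (rt y ?K)) (ev f (list_encode (rev ys @ (y # acc))) K)"
    using Cons.IH[of "y # acc"] by metis
  then have "reaches orc (rt y ?K) (ev f (list_encode (rev ys @ (y # acc))) K)"
    by (rule reaches_step)
  then have "reaches orc (rt y ?K) (ev f (list_encode (rev (y # ys) @ acc)) K)"
    by simp
  ultimately show ?case by (rule reaches_trans)
qed

text \<open>The stack \<open>K\<close> is arbitrary so that the induction hypotheses apply when
  frames have been pushed.\<close>

lemma evaluates_reaches:
  assumes "evaluates X p xs v"
  shows "reaches (total_oracle X) (ev (prog_code p) (list_encode xs) K) (rt v K)"
  using assms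
proof (induction arbitrary: K rule: evaluates.induct)
  case (zero xs)
  show ?case by (rule reaches_step) (simp add: mstep_ev eval_step_def reaches_refl)
next
  case (succ n)
  show ?case by (rule reaches_step) (simp add: mstep_ev eval_step_def reaches_refl)
next
  case (query n)
  show ?case
    by (rule reaches_step) (simp add: mstep_ev eval_step_def total_oracle_def reaches_refl)
next
  case (proj i xs)
  then show ?case
    by - (rule reaches_step, simp add: mstep_ev eval_step_def code_nth_list_encode reaches_refl)
next
  case (comp xs gs ys f z)
  have "list_all2 (\<lambda>g y. \<forall>K. reaches (total_oracle X) (ev g (list_encode xs) K) (rt y K))
      (rev (map prog_code gs)) (rev ys)"
    using comp(1) by (auto simp: list.rel_map elim!: list_all2_mono)
  from reaches_next_arg[OF this, of "prog_code f" "[]" K]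
  have "reaches (total_oracle X) (ev (prog_code (Comp f gs)) (list_encode xs) K)
      (ev (prog_code f) (list_encode ys) K)"
    by - (rule reaches_step, simp add: mstep_ev eval_step_def)
  then show ?case by (rule reaches_trans) (rule comp.IH(2))
next
  case (rec_0 f xs y g)
  then show ?case by - (rule reaches_step, simp add: mstep_ev eval_step_def)
next
  case (rec_Suc f g n xs y z)
  let ?K = "code_Cons (pr 1 (pr (prog_code g) (list_encode (n # xs)))) K"
  have "reaches (total_oracle X) (ev (prog_code (Rec f g)) (list_encode (Suc n # xs)) K) (rt y ?K)"
    using rec_Suc.IH(1)[of ?K] by - (rule reaches_step, simp add: mstep_ev eval_step_def)
  moreover have "reaches (total_oracle X) (rt y ?K) (rt z K)"
    using rec_Suc.IH(2)[of K] by - (rule reaches_step, simp add: mstep_rt ret_step_def)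
  ultimately show ?case by (rule reaches_trans)
next
  case (mu f n xs)
  let ?st = "\<lambda>m. ev (prog_code f) (list_encode (m # xs))
    (code_Cons (pr 2 (pr (prog_code f) (list_encode (m # xs)))) K)"
  have "m \<le> n \<Longrightarrow> reaches (total_oracle X) (ev (prog_code (Mu f)) (list_encode xs) K) (?st m)" for m
  proof (induction m)
    case 0
    show ?case by (rule reaches_step) (simp add: mstep_ev eval_step_def reaches_refl)
  next
    case (Suc m)
    then obtain y where y: "\<And>K. reaches (total_oracle X)
        (ev (prog_code f) (list_encode (m # xs)) K) (rt (Suc y) K)"
      using mu.IH(2) by (meson Suc_le_lessD)
    have "reaches (total_oracle X) (?st m) (?st (Suc m))"
      by (rule reaches_trans[OF y reaches_step]) (simp add: mstep_rt ret_step_def reaches_refl)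
    with Suc show ?case by (intro reaches_trans[OF Suc.IH]) auto
  qed
  then have "reaches (total_oracle X) (ev (prog_code (Mu f)) (list_encode xs) K) (?st n)"
    by simp
  moreover have "reaches (total_oracle X) (?st n) (rt n K)"
    by (rule reaches_trans[OF mu.IH(1) reaches_step]) (simp add: mstep_rt ret_step_def reaches_refl)
  ultimately show ?case by (rule reaches_trans)
qed

section \<open>Uniqueness of results and finite use of the oracle\<close>

lemma prod_decode_0 [simp]: "prod_decode 0 = (0, 0)"
  using prod_encode_inverse[of "(0, 0)"] by (simp add: prod_encode_def)

lemma rt_eq [simp]: "rt v K = rt w L \<longleftrightarrow> v = w \<and> K = L"
  by (simp add: rt_def)

lemma rt_neq_0 [simp]: "rt v K \<noteq> 0"
  using le_prod_encode_1[of 2 "pr v K"] by (simp add: rt_def del: le_prod_encode_1)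

lemma mrun_halted: "mrun orc (rt v 0) s = rt v 0"
  by (induction s) (simp_all add: mstep_def, simp_all add: rt_def)

lemma reaches_halted_unique:
  assumes "reaches orc st (rt v 0)" and "reaches orc st (rt w 0)" shows "v = w"
proof -
  obtain s t where "mrun orc st s = rt v 0" "mrun orc st t = rt w 0"
    using assms by (auto simp: reaches_def)
  then have "mrun orc st (s + t) = rt v 0" "mrun orc st (t + s) = rt w 0"
    by (simp_all add: mrun_add mrun_halted)
  then show ?thesis by (simp add: add.commute)
qed

lemma mstep_extend:
  assumes "\<And>i. orc i \<noteq> 0 \<Longrightarrow> orc' i = orc i" and "mstep orc st \<noteq> 0"
  shows "mstep orc' st = mstep orc st"
  using assms by (auto simp: mstep_def eval_step_def)

text \<open>As \<open>0\<close> is absorbing, a run that is not at \<open>0\<close> has met no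
  undefined query, so further answers do not change it.\<close>

lemma mrun_extend:
  assumes "\<And>i. orc i \<noteq> 0 \<Longrightarrow> orc' i = orc i" and "mrun orc st s \<noteq> 0"
  shows "mrun orc' st s = mrun orc st s"
  using assms(2)
proof (induction s)
  case (Suc s)
  have "mstep orc 0 = 0" by (simp add: mstep_def)
  then have "mrun orc st s \<noteq> 0" using Suc.prems by (metis mrun_Suc)
  then show ?case using Suc mstep_extend[OF assms(1)] by simp
qed simp

text \<open>A step can only query the head of the current argument list, so finitely many steps
  depend on finitely many positions.\<close>

lemma mrun_use: "\<exists>m. \<forall>orc'. (\<forall>i<m. orc' i = orc i) \<longrightarrow> mrun orc' st s = mrun orc st s"
proof (induction s)
  case (Suc s)
  then obtain m where m: "\<And>orc'. (\<forall>i<m. orc' i = orc i) \<Longrightarrow> mrun orc' st s = mrun orc st s"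
    by blast
  let ?i = "code_hd (p1 (p2 (p2 (mrun orc st s))))"
  have "mrun orc' st (Suc s) = mrun orc st (Suc s)"
    if "\<forall>i<max m (Suc ?i). orc' i = orc i" for orc'
  proof -
    have "orc' ?i = orc ?i" using that by simp
    then show ?thesis using m[of orc'] that by (simp add: mstep_def eval_step_def)
  qed
  then show ?case by blast
qed simp

section \<open>Finite oracles\<close>

text \<open>The pair \<open>(m, w)\<close> stands for the string of the first \<open>m\<close> binary digits of \<open>w\<close>.\<close>
definition str_oracle :: "nat \<Rightarrow> nat \<Rightarrow> nat" where
  "str_oracle \<rho> i = (if i < p1 \<rho> then Suc (of_bool (bit (p2 \<rho>) i)) else 0)"

definition cyl :: "nat \<Rightarrow> (nat \<Rightarrow> bool) set" where
  "cyl \<rho> = {Y. \<forall>i<p1 \<rho>. Y i = bit (p2 \<rho>) i}"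

definition extends :: "nat \<Rightarrow> nat \<Rightarrow> bool" where
  "extends \<rho> \<sigma> \<longleftrightarrow> p1 \<sigma> \<le> p1 \<rho> \<and> p2 \<rho> mod 2 ^ p1 \<sigma> = p2 \<sigma> mod 2 ^ p1 \<sigma>"

lemma extends_iff: "extends \<rho> \<sigma> \<longleftrightarrow> p1 \<sigma> \<le> p1 \<rho> \<and> (\<forall>i<p1 \<sigma>. bit (p2 \<rho>) i = bit (p2 \<sigma>) i)"
  unfolding extends_def by (auto simp flip: take_bit_eq_mod simp: bit_eq_iff bit_take_bit_iff)

lemma cyl_mono: "extends \<rho> \<sigma> \<Longrightarrow> cyl \<rho> \<subseteq> cyl \<sigma>"
  by (auto simp: extends_iff cyl_def)

lemma extends_refl: "extends \<rho> \<rho>"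
  by (simp add: extends_def)

lemma extends_trans: "extends \<rho> \<sigma> \<Longrightarrow> extends \<sigma> \<tau> \<Longrightarrow> extends \<rho> \<tau>"
  by (auto simp: extends_iff)

lemma obtain_prefix:
  obtains \<rho> where "p1 \<rho> = m" and "Y \<in> cyl \<rho>"
proof
  let ?\<rho> = "pr m (horner_sum of_bool 2 (map Y [0..<m]))"
  show "p1 ?\<rho> = m" by simp
  show "Y \<in> cyl ?\<rho>" by (simp add: cyl_def bit_horner_sum_bit_iff)
qed

lemma extends_if_cyl: "Y \<in> cyl \<rho> \<Longrightarrow> Y \<in> cyl \<sigma> \<Longrightarrow> p1 \<sigma> \<le> p1 \<rho> \<Longrightarrow> extends \<rho> \<sigma>"
  by (auto simp: extends_iff cyl_def)

lemma cyl_nonempty: "cyl \<rho> \<noteq> {}"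
  unfolding cyl_def by auto

section \<open>Acceptance with a finite oracle\<close>

definition accepts :: "nat \<Rightarrow> nat \<Rightarrow> nat \<Rightarrow> nat \<Rightarrow> bool" where
  "accepts e \<rho> c s \<longleftrightarrow> mrun (str_oracle \<rho>) (ev e (code_Cons c 0) 0) s = rt 1 0"

text \<open>Completing the string to \<open>Y\<close> preserves the halting run; simulating the
  evaluation gives a run that halts with \<open>v\<close>, and results are unique.\<close>

lemma accepts_sound:
  assumes "evaluates Y p [c] v" and "accepts (prog_code p) \<rho> c s" and "Y \<in> cyl \<rho>"
  shows "v = 1"
proof -
  have "mrun (total_oracle Y) (ev (prog_code p) (code_Cons c 0) 0) s = rt 1 0"
  proof (subst mrun_extend[of "str_oracle \<rho>" "total_oracle Y"])
    show "total_oracle Y i = str_oracle \<rho> i" if "str_oracle \<rho> i \<noteq> 0" for i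
      using that assms(3) by (auto simp: str_oracle_def total_oracle_def cyl_def split: if_splits)
  qed (use assms(2) in \<open>simp_all add: accepts_def\<close>)
  then have "reaches (total_oracle Y) (ev (prog_code p) (code_Cons c 0) 0) (rt 1 0)"
    unfolding reaches_def by blast
  then show ?thesis
    using evaluates_reaches[OF assms(1), of 0] reaches_halted_unique by fastforce
qed

lemma accepts_complete:
  assumes "evaluates Y p [c] 1"
  obtains s m where "\<And>\<rho>. m \<le> p1 \<rho> \<Longrightarrow> Y \<in> cyl \<rho> \<Longrightarrow> accepts (prog_code p) \<rho> c s"
proof -
  obtain s where s: "mrun (total_oracle Y) (ev (prog_code p) (code_Cons c 0) 0) s = rt 1 0"
    using evaluates_reaches[OF assms, of 0] by (auto simp: reaches_def)
  obtain m where m: "\<And>orc'. (\<forall>i<m. orc' i = total_oracle Y i) \<Longrightarrow>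
      mrun orc' (ev (prog_code p) (code_Cons c 0) 0) s = rt 1 0"
    using mrun_use[of "total_oracle Y" "ev (prog_code p) (code_Cons c 0) 0" s] s by auto
  have "accepts (prog_code p) \<rho> c s" if "m \<le> p1 \<rho>" "Y \<in> cyl \<rho>" for \<rho>
    unfolding accepts_def using that
    by (intro m) (auto simp: str_oracle_def total_oracle_def cyl_def)
  then show thesis by (rule that)
qed

lemma comput_ev [comput_intros]:
  "comput X n f \<Longrightarrow> comput X n g \<Longrightarrow> comput X n h \<Longrightarrow> comput X n (\<lambda>xs. ev (f xs) (g xs) (h xs))"
  unfolding ev_def by (intro comput_intros)

lemma comput_rt [comput_intros]:
  "comput X n f \<Longrightarrow> comput X n g \<Longrightarrow> comput X n (\<lambda>xs. rt (f xs) (g xs))"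
  unfolding rt_def by (intro comput_intros)

lemma comput_next_arg [comput_intros]:
  "comput X n f \<Longrightarrow> comput X n g \<Longrightarrow> comput X n h \<Longrightarrow> comput X n i \<Longrightarrow> comput X n j \<Longrightarrow>
    comput X n (\<lambda>xs. next_arg (f xs) (g xs) (h xs) (i xs) (j xs))"
  unfolding next_arg_def by (intro comput_intros)

lemma comput_ret_step [comput_intros]:
  "comput X n f \<Longrightarrow> comput X n g \<Longrightarrow> comput X n h \<Longrightarrow> comput X n i \<Longrightarrow>
    comput X n (\<lambda>xs. ret_step (f xs) (g xs) (h xs) (i xs))"
  unfolding ret_step_def by (intro comput_intros)

lemma comput_str_oracle [comput_intros]:
  "comput X n f \<Longrightarrow> comput X n g \<Longrightarrow> comput X n (\<lambda>xs. str_oracle (f xs) (g xs))"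
  unfolding str_oracle_def by (intro comput_intros)

lemma comput_eval_step [comput_intros]:
  "comput X n f \<Longrightarrow> comput X n g \<Longrightarrow> comput X n h \<Longrightarrow> comput X n i \<Longrightarrow>
    comput X n (\<lambda>xs. eval_step (str_oracle (f xs)) (g xs) (h xs) (i xs))"
  unfolding eval_step_def by (intro comput_intros)

lemma comput_mstep [comput_intros]:
  "comput X n f \<Longrightarrow> comput X n g \<Longrightarrow> comput X n (\<lambda>xs. mstep (str_oracle (f xs)) (g xs))"
  unfolding mstep_def by (intro comput_intros)

lemma comput_mrun [comput_intros]:
  assumes "comput X n f" and "comput X n g" and "comput X n h"
  shows "comput X n (\<lambda>xs. mrun (str_oracle (f xs)) (g xs) (h xs))"
proof -
  \<comment> \<open>\<open>comput_rec\<close> has a single parameter, so oracle and initial state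
    are passed as a pair.\<close>
  have "comput X n (\<lambda>xs. rec_nat (p2 (pr (f xs) (g xs)))
      (\<lambda>i y. mstep (str_oracle (p1 (pr (f xs) (g xs)))) y) (h xs))"
    by (rule comput_rec[where b = p2 and h = "\<lambda>i y z. mstep (str_oracle (p1 z)) y"
          and z = "\<lambda>xs. pr (f xs) (g xs)"])
      (intro comput_intros assms; simp)+
  then show ?thesis by (simp add: mrun_def)
qed

lemma decid_accepts [comput_intros]:
  "comput X n f \<Longrightarrow> comput X n g \<Longrightarrow> comput X n h \<Longrightarrow> comput X n i \<Longrightarrow>
    decid X n (\<lambda>xs. accepts (f xs) (g xs) (h xs) (i xs))"
  unfolding accepts_def by (intro comput_intros)

lemma decid_extends [comput_intros]:
  "comput X n f \<Longrightarrow> comput X n g \<Longrightarrow> decid X n (\<lambda>xs. extends (f xs) (g xs))"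
  unfolding extends_def by (intro comput_intros)

section \<open>The boards\<close>

definition lit :: "nat \<Rightarrow> nat \<Rightarrow> nat \<Rightarrow> nat" where
  "lit c a b = literal_code (Pos (Rel c [Elem a, Elem b]))"

lemma lit_eq: "lit c a b = 2 * Suc (2 * pr c (code_Cons (2 * a) (code_Cons (2 * b) 0)))"
  by (simp add: lit_def sum_encode_def)

lemma comput_lit [comput_intros]:
  "comput X n f \<Longrightarrow> comput X n g \<Longrightarrow> comput X n h \<Longrightarrow> comput X n (\<lambda>xs. lit (f xs) (g xs) (h xs))"
  unfolding lit_eq by (intro comput_intros)

text \<open>
  Board \<open>(e, \<sigma>)\<close> plays against program \<open>e\<close>. The counter of a state is \<open>0\<close> while an element to
  watch is searched for (\<open>base\<close> is the string on which it was found), \<open>2k + 1\<close> while the move to be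
  killed in round \<open>k\<close> is searched for, and \<open>2k + 2\<close> while the process waits for the mark with which
  the watched element must respond. Colour \<open>(0, n)\<close> is the tag of board \<open>n\<close>, \<open>(1, k, r)\<close> the move
  \<open>r\<close> in round \<open>k\<close>, and \<open>(2, j)\<close> the mark \<open>j\<close>.
\<close>
definition counter :: "nat \<Rightarrow> nat" where "counter st = p1 st"
definition watched :: "nat \<Rightarrow> nat" where "watched st = p1 (p2 st)"
definition base :: "nat \<Rightarrow> nat" where "base st = p1 (p2 (p2 st))"
definition victim :: "nat \<Rightarrow> nat" where "victim st = p1 (p2 (p2 (p2 st)))"
definition recent :: "nat \<Rightarrow> nat" where "recent st = p2 (p2 (p2 (p2 st)))"

definition mk_state :: "nat \<Rightarrow> nat \<Rightarrow> nat \<Rightarrow> nat \<Rightarrow> nat \<Rightarrow> nat" where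
  "mk_state c a b q \<rho> = pr c (pr a (pr b (pr q \<rho>)))"

lemma mk_state_simps [simp]:
  "counter (mk_state c a b q \<rho>) = c" "watched (mk_state c a b q \<rho>) = a"
  "base (mk_state c a b q \<rho>) = b" "victim (mk_state c a b q \<rho>) = q"
  "recent (mk_state c a b q \<rho>) = \<rho>"
  by (simp_all add: mk_state_def counter_def watched_def base_def victim_def recent_def)

text \<open>Both counters of round \<open>k\<close>, \<open>2k + 1\<close> and
  \<open>2k + 2\<close>, give \<open>k\<close>; the initial counter \<open>0\<close> also counts as
  round \<open>0\<close>.\<close>

definition round_of :: "nat \<Rightarrow> nat" where "round_of c = (c - 1) div 2"

text \<open>The strings \<open>p1 k\<close> form the list in which every string recurs. If
  \<open>p1 k\<close> does not extend \<open>base\<close>, round \<open>k\<close> is played on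
  \<open>base\<close> itself. The mark is sought on an extension of the string that showed the move,
  so that one real shows both.\<close>

definition target :: "nat \<Rightarrow> nat \<Rightarrow> nat" where
  "target n st = (if counter st = 0 then p2 n
     else if odd (counter st) then
       (if extends (p1 (round_of (counter st))) (base st) then p1 (round_of (counter st)) else base st)
     else recent st)"

text \<open>\<open>r\<close> is a guess for the move to be killed; the first one found becomes the
  victim.\<close>

definition wanted :: "nat \<Rightarrow> nat \<Rightarrow> nat \<Rightarrow> nat" where
  "wanted n st r = (if counter st = 0 then pr 0 n
     else if odd (counter st) then pr 1 (pr (round_of (counter st)) r)
     else pr 2 (round_of (counter st)))"

definition new_watched :: "nat \<Rightarrow> nat \<Rightarrow> nat" where
  "new_watched st a = (if counter st = 0 then a else watched st)"

definition succeeds :: "nat \<Rightarrow> nat \<Rightarrow> nat \<Rightarrow> nat \<Rightarrow> nat \<Rightarrow> nat \<Rightarrow> nat \<Rightarrow> bool" where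
  "succeeds n st \<rho> a b s r \<longleftrightarrow> extends \<rho> (target n st) \<and>
     accepts (p1 n) \<rho> (lit (wanted n st r) (new_watched st a) b) s"

text \<open>\<open>j\<close> codes a candidate \<open>(\<rho>, a, b, s, r)\<close>. The watched
  element and \<open>base\<close> are fixed by the first success.\<close>

definition advance :: "nat \<Rightarrow> nat \<Rightarrow> nat \<Rightarrow> nat" where
  "advance n st j =
    (if succeeds n st (p1 j) (p1 (p2 j)) (p1 (p2 (p2 j))) (p1 (p2 (p2 (p2 j)))) (p2 (p2 (p2 (p2 j))))
     then mk_state (Suc (counter st)) (new_watched st (p1 (p2 j)))
       (if counter st = 0 then p1 j else base st) (p2 (p2 (p2 (p2 j)))) (p1 j)
     else st)"

text \<open>Passing from \<open>t\<close> to \<open>p1 t\<close> makes every candidate come up infinitely often.\<close>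
definition board :: "nat \<Rightarrow> nat \<Rightarrow> nat" where
  "board n t = rec_nat 0 (\<lambda>t st. advance n st (p1 t)) t"

lemma board_0 [simp]: "board n 0 = 0"
  and board_Suc [simp]: "board n (Suc t) = advance n (board n t) (p1 t)"
  by (simp_all add: board_def)

lemma comput_state [comput_intros]:
  "comput X n f \<Longrightarrow> comput X n (\<lambda>xs. counter (f xs))"
  "comput X n f \<Longrightarrow> comput X n (\<lambda>xs. watched (f xs))"
  "comput X n f \<Longrightarrow> comput X n (\<lambda>xs. base (f xs))"
  "comput X n f \<Longrightarrow> comput X n (\<lambda>xs. victim (f xs))"
  "comput X n f \<Longrightarrow> comput X n (\<lambda>xs. recent (f xs))"
  "comput X n f \<Longrightarrow> comput X n (\<lambda>xs. round_of (f xs))"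
  unfolding counter_def watched_def base_def victim_def recent_def round_of_def
  by (intro comput_intros; assumption)+

lemma comput_mk_state [comput_intros]:
  "comput X n f \<Longrightarrow> comput X n g \<Longrightarrow> comput X n h \<Longrightarrow> comput X n i \<Longrightarrow> comput X n j \<Longrightarrow>
    comput X n (\<lambda>xs. mk_state (f xs) (g xs) (h xs) (i xs) (j xs))"
  unfolding mk_state_def by (intro comput_intros)

lemma comput_target [comput_intros]:
  "comput X n f \<Longrightarrow> comput X n g \<Longrightarrow> comput X n (\<lambda>xs. target (f xs) (g xs))"
  unfolding target_def by (intro comput_intros)

lemma comput_wanted [comput_intros]:
  "comput X n f \<Longrightarrow> comput X n g \<Longrightarrow> comput X n h \<Longrightarrow>
    comput X n (\<lambda>xs. wanted (f xs) (g xs) (h xs))"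
  unfolding wanted_def by (intro comput_intros)

lemma comput_new_watched [comput_intros]:
  "comput X n f \<Longrightarrow> comput X n g \<Longrightarrow> comput X n (\<lambda>xs. new_watched (f xs) (g xs))"
  unfolding new_watched_def by (intro comput_intros)

lemma comput_advance [comput_intros]:
  "comput X n f \<Longrightarrow> comput X n g \<Longrightarrow> comput X n h \<Longrightarrow>
    comput X n (\<lambda>xs. advance (f xs) (g xs) (h xs))"
  unfolding advance_def succeeds_def by (intro comput_intros)

lemma comput_board [comput_intros]:
  assumes "comput X n f" and "comput X n g"
  shows "comput X n (\<lambda>xs. board (f xs) (g xs))"
  unfolding board_def
  by (rule comput_rec[where b = "\<lambda>_. 0" and h = "\<lambda>t st z. advance z st (p1 t)" and z = f])
    (intro comput_intros assms; simp)+

section \<open>The course of a board\<close>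

abbreviation count_at :: "nat \<Rightarrow> nat \<Rightarrow> nat" where "count_at n t \<equiv> counter (board n t)"
abbreviation round_at :: "nat \<Rightarrow> nat \<Rightarrow> nat" where "round_at n t \<equiv> round_of (count_at n t)"

definition killing :: "nat \<Rightarrow> bool" where
  "killing c \<longleftrightarrow> c \<noteq> 0 \<and> even c"

lemma advance_cases: "advance n st j = st \<or> counter (advance n st j) = Suc (counter st)"
  by (simp add: advance_def)

lemma count_at_mono: "t \<le> t' \<Longrightarrow> count_at n t \<le> count_at n t'"
proof (induction rule: dec_induct)
  case (step t')
  then show ?case using advance_cases[of n "board n t'" "p1 t'"] by auto
qed simp

text \<open>Every change of state raises the counter.\<close>

lemma board_const:
  assumes "t \<le> t'" and "count_at n t' = count_at n t" shows "board n t' = board n t"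
  using assms
proof (induction rule: dec_induct)
  case (step t')
  have "count_at n t \<le> count_at n t'" using step.hyps(1) by (rule count_at_mono)
  then show ?case
    using step advance_cases[of n "board n t'" "p1 t'"] by auto
qed simp

lemma board_determined: "count_at n t = count_at n t' \<Longrightarrow> board n t = board n t'"
  by (metis board_const nat_le_linear)

lemma round_of_mono: "c \<le> c' \<Longrightarrow> round_of c \<le> round_of c'"
  by (simp add: round_of_def div_le_mono)

lemma round_at_mono: "t \<le> t' \<Longrightarrow> round_at n t \<le> round_at n t'"
  by (simp add: count_at_mono round_of_mono)

lemma killing_counter: "killing c \<Longrightarrow> c = 2 * Suc (round_of c)"
  unfolding killing_def round_of_def by presburger

text \<open>A round has a single killing counter, hence a single victim; this is what makes an error
  in it improbable.\<close>

lemma victim_unique: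
  assumes "killing (count_at n t)" "killing (count_at n t')" "round_at n t = round_at n t'"
  shows "victim (board n t) = victim (board n t')"
proof -
  have "count_at n t = count_at n t'"
    using killing_counter[OF assms(1)] killing_counter[OF assms(2)] assms(3) by simp
  then show ?thesis using board_determined[of n t t'] by simp
qed

section \<open>The players\<close>

text \<open>The \<open>k\<close> bits at \<open>pr k i\<close>, read as a binary number, so that a
  given value has probability at most \<open>2^-k\<close>.\<close>

definition block :: "(nat \<Rightarrow> bool) \<Rightarrow> nat \<Rightarrow> nat" where
  "block X k = rec_nat 0 (\<lambda>i y. 2 * y + of_bool (X (pr k i))) k"

text \<open>
  A player is a code \<open>(i, n, d, t, r)\<close>: it plays on board \<open>n\<close> from stage \<open>t\<close> on, with first move
  \<open>r\<close> and \<open>d\<close> initial marks; \<open>i\<close> only serves to have infinitely many copies of it.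
\<close>
definition own_board :: "nat \<Rightarrow> nat" where "own_board x = p1 (p2 x)"
definition init_marks :: "nat \<Rightarrow> nat" where "init_marks x = p1 (p2 (p2 x))"
definition start :: "nat \<Rightarrow> nat" where "start x = p1 (p2 (p2 (p2 x)))"
definition first_move :: "nat \<Rightarrow> nat" where "first_move x = p2 (p2 (p2 (p2 x)))"

definition mk_player :: "nat \<Rightarrow> nat \<Rightarrow> nat \<Rightarrow> nat \<Rightarrow> nat" where
  "mk_player n d t r = pr 0 (pr n (pr d (pr t r)))"

lemma mk_player_simps [simp]:
  "own_board (mk_player n d t r) = n" "init_marks (mk_player n d t r) = d"
  "start (mk_player n d t r) = t" "first_move (mk_player n d t r) = r"
  by (simp_all add: mk_player_def own_board_def init_marks_def start_def first_move_def)

text \<open>Prescribing the first move lets a player imitate one built from another real on a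
  stalled board, where the final round alone matters.\<close>

definition played :: "(nat \<Rightarrow> bool) \<Rightarrow> nat \<Rightarrow> nat \<Rightarrow> nat" where
  "played X x k = (if k = round_at (own_board x) (start x) then first_move x else block X k)"

definition hit :: "(nat \<Rightarrow> bool) \<Rightarrow> nat \<Rightarrow> nat \<Rightarrow> bool" where
  "hit X x t \<longleftrightarrow> killing (count_at (own_board x) t) \<and>
     victim (board (own_board x) t) = played X x (round_at (own_board x) t)"

text \<open>A hit in round \<open>k\<close> brings all marks up to \<open>k\<close>, so that finitely many marks form a number.\<close>
definition marks :: "(nat \<Rightarrow> bool) \<Rightarrow> nat \<Rightarrow> nat \<Rightarrow> nat" where
  "marks X x s = rec_nat (init_marks x) (\<lambda>s y. if hit X x (start x + s)
     then max y (Suc (round_at (own_board x) (start x + s))) else y) s"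

lemma marks_0 [simp]: "marks X x 0 = init_marks x"
  and marks_Suc [simp]: "marks X x (Suc s) = (if hit X x (start x + s)
     then max (marks X x s) (Suc (round_at (own_board x) (start x + s))) else marks X x s)"
  by (simp_all add: marks_def)

text \<open>A move is forgotten by granting all moves of its round, so that colours are only ever
  added and can be enumerated.\<close>

definition holds :: "(nat \<Rightarrow> bool) \<Rightarrow> nat \<Rightarrow> nat \<Rightarrow> nat \<Rightarrow> bool" where
  "holds X x s c \<longleftrightarrow> c = pr 0 (own_board x) \<or>
    (p1 c = 1 \<and> (p1 (p2 c) < round_at (own_board x) (start x + s) \<or>
       p1 (p2 c) = round_at (own_board x) (start x + s) \<and> p2 (p2 c) = played X x (p1 (p2 c)))) \<or>
    (p1 c = 2 \<and> p2 c < marks X x s)"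

definition colours :: "(nat \<Rightarrow> bool) \<Rightarrow> nat \<Rightarrow> nat set" where
  "colours X x = {c. \<exists>s. holds X x s c}"

text \<open>\<open>v\<close> codes a colour and a stage. The default value is the tag, which the
  player has anyway.\<close>

definition colour :: "(nat \<Rightarrow> bool) \<Rightarrow> nat \<Rightarrow> nat \<Rightarrow> nat" where
  "colour X x v = (if holds X x (p2 v) (p1 v) then p1 v else pr 0 (own_board x))"

section \<open>Computability and enumeration of the colours\<close>

lemma comput_block [comput_intros]:
  assumes "comput X n f" shows "comput X n (\<lambda>xs. block X (f xs))"
  unfolding block_def
  by (rule comput_rec[where b = "\<lambda>_. 0" and h = "\<lambda>i y z. 2 * y + of_bool (X (pr z i))" and z = f])
    (intro comput_intros assms; simp)+

lemma comput_player [comput_intros]: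
  "comput X n f \<Longrightarrow> comput X n (\<lambda>xs. own_board (f xs))"
  "comput X n f \<Longrightarrow> comput X n (\<lambda>xs. init_marks (f xs))"
  "comput X n f \<Longrightarrow> comput X n (\<lambda>xs. start (f xs))"
  "comput X n f \<Longrightarrow> comput X n (\<lambda>xs. first_move (f xs))"
  unfolding own_board_def init_marks_def start_def first_move_def
  by (intro comput_intros; assumption)+

lemma comput_played [comput_intros]:
  "comput X n f \<Longrightarrow> comput X n g \<Longrightarrow> comput X n (\<lambda>xs. played X (f xs) (g xs))"
  unfolding played_def by (intro comput_intros)

lemma decid_hit [comput_intros]:
  "comput X n f \<Longrightarrow> comput X n g \<Longrightarrow> decid X n (\<lambda>xs. hit X (f xs) (g xs))"
  unfolding hit_def killing_def by (intro comput_intros)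

lemma comput_marks [comput_intros]:
  assumes "comput X n f" and "comput X n g" shows "comput X n (\<lambda>xs. marks X (f xs) (g xs))"
  unfolding marks_def
  by (rule comput_rec[where b = init_marks and h = "\<lambda>s y x. if hit X x (start x + s)
     then max y (Suc (round_at (own_board x) (start x + s))) else y" and z = f])
    (intro comput_intros assms; simp)+

lemma comput_colour [comput_intros]:
  "comput X n f \<Longrightarrow> comput X n g \<Longrightarrow> comput X n (\<lambda>xs. colour X (f xs) (g xs))"
  unfolding colour_def holds_def by (intro comput_intros)

lemma marks_mono: "s \<le> s' \<Longrightarrow> marks X x s \<le> marks X x s'"
  by (induction rule: dec_induct) auto

lemma holds_mono:
  assumes "holds X x s c" and "s \<le> s'" shows "holds X x s' c"
proof -
  have "round_at (own_board x) (start x + s) \<le> round_at (own_board x) (start x + s')"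
    using assms(2) by (intro round_at_mono) simp
  moreover have "marks X x s \<le> marks X x s'" using assms(2) by (rule marks_mono)
  ultimately show ?thesis using assms(1) unfolding holds_def by auto
qed

text \<open>A colour that holds does so at all later stages, each of which gives another
  \<open>v\<close>.\<close>

lemma infinite_colour:
  assumes "c \<in> colours X x" shows "infinite {v. colour X x v = c}"
proof -
  obtain s where s: "holds X x s c" using assms by (auto simp: colours_def)
  have "range (\<lambda>i. pr c (s + i)) \<subseteq> {v. colour X x v = c}"
    using holds_mono[OF s] by (auto simp: colour_def)
  moreover have "inj (\<lambda>i. pr c (s + i))" by (auto intro: injI)
  ultimately show ?thesis using finite_subset range_inj_infinite by blast
qed

lemma range_colour: "range (colour X x) = colours X x"
proof
  show "range (colour X x) \<subseteq> colours X x"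
    by (auto simp: colour_def colours_def) (auto simp: holds_def)
  show "colours X x \<subseteq> range (colour X x)"
    using infinite_colour by (fastforce dest: infinite_imp_nonempty)
qed

lemma colours_copy: "colours X (pr i (p2 x)) = colours X x"
proof -
  have "holds X (pr i (p2 x)) s c = holds X x s c" for s c
  proof -
    have "own_board (pr i (p2 x)) = own_board x" "init_marks (pr i (p2 x)) = init_marks x"
      "start (pr i (p2 x)) = start x" "first_move (pr i (p2 x)) = first_move x"
      by (simp_all add: own_board_def init_marks_def start_def first_move_def)
    then show ?thesis by (simp add: holds_def marks_def hit_def played_def cong: if_cong)
  qed
  then show ?thesis by (simp add: colours_def)
qed

lemma infinite_copies: "infinite {x'. colours X x' = colours X x}"
proof -
  have "range (\<lambda>i. pr i (p2 x)) \<subseteq> {x'. colours X x' = colours X x}"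
    by (auto simp: colours_copy)
  moreover have "inj (\<lambda>i. pr i (p2 x))" by (auto intro: injI)
  ultimately show ?thesis using finite_subset range_inj_infinite by blast
qed

section \<open>The structure built from a real\<close>

definition lang2 :: lang where
  "lang2 = \<lparr>rel_arity = (\<lambda>_. Some 2), fun_arity = (\<lambda>_. None)\<rparr>"

text \<open>
  The pairs \<open>(x, v)\<close> are the elements belonging to the player \<open>x\<close>, and \<open>R c (x, u) (x, v)\<close> says
  that \<open>(x, v)\<close> has colour \<open>c\<close>.
\<close>
definition struc_of :: "(nat \<Rightarrow> bool) \<Rightarrow> nat struc" where
  "struc_of X = \<lparr>universe = UNIV,
     interp_rel = (\<lambda>c us. p1 (us ! 0) = p1 (us ! 1) \<and> colour X (p1 (us ! 0)) (p2 (us ! 1)) = c),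
     interp_fun = (\<lambda>_ _. 0)\<rparr>"

lemma computable_fromI:
  assumes "comput X 1 (\<lambda>xs. f (xs ! 0))" shows "computable_from X f"
proof -
  obtain p where p: "\<And>xs. length xs = 1 \<Longrightarrow> evaluates X p xs (f (xs ! 0))"
    using assms by (auto simp: comput_def)
  have "evaluates X p [n] (f n)" for n using p[of "[n]"] by simp
  then show ?thesis by (auto simp: computable_from_def)
qed

lemma computable_lang2: "computable_lang lang2"
proof -
  have "computable_from X (\<lambda>_. c)" for X c
    using comput_const[of X 1 c] by (rule computable_fromI)
  then show ?thesis by (simp add: computable_lang_def lang2_def)
qed

lemma is_struc_struc_of: "is_struc lang2 (struc_of X)"
  by (simp add: is_struc_def struc_of_def lang2_def)

section \<open>The real computes the atomic diagram\<close>

lemma wf_cterm_lang2: "wf_cterm lang2 A t \<longleftrightarrow> (\<exists>a\<in>A. t = Elem a)"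
  by (cases t) (auto simp: lang2_def)

lemma length_2_conv: "length xs = 2 \<longleftrightarrow> (\<exists>a b. xs = [a, b])"
  by (auto simp: length_Suc_conv numeral_2_eq_2)

lemma wf_atom_lang2:
  "wf_atom lang2 A \<phi> \<longleftrightarrow>
     (\<exists>a\<in>A. \<exists>b\<in>A. \<phi> = Eq (Elem a) (Elem b) \<or> (\<exists>c. \<phi> = Rel c [Elem a, Elem b]))"
proof (cases \<phi>)
  case (Eq s t)
  then show ?thesis by (auto simp: wf_cterm_lang2)
next
  case (Rel c ts)
  have "wf_atom lang2 A \<phi> \<longleftrightarrow> length ts = 2 \<and> (\<forall>t\<in>set ts. \<exists>a\<in>A. t = Elem a)"
    by (auto simp: Rel wf_cterm_lang2) (auto simp: lang2_def)
  then show ?thesis by (auto simp: Rel length_2_conv)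
qed

text \<open>The last binary digit of a literal code is its sign, the next one tells relations from
  equations, and codes of elements are even. The argument list \<open>l\<close> of a relation must
  have exactly two entries.\<close>

definition diagram_pred :: "(nat \<Rightarrow> bool) \<Rightarrow> nat \<Rightarrow> bool" where
  "diagram_pred X n \<longleftrightarrow>
    (if odd (n div 2) then
       (let b = n div 2 div 2; l = p2 b in
         l \<noteq> 0 \<and> code_tl l \<noteq> 0 \<and> code_tl (code_tl l) = 0 \<and>
         \<not> odd (code_hd l) \<and> \<not> odd (code_hd (code_tl l)) \<and>
         (if odd n then \<not> (p1 (code_hd l div 2) = p1 (code_hd (code_tl l) div 2) \<and>
            colour X (p1 (code_hd l div 2)) (p2 (code_hd (code_tl l) div 2)) = p1 b)
          else p1 (code_hd l div 2) = p1 (code_hd (code_tl l) div 2) \<and>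
            colour X (p1 (code_hd l div 2)) (p2 (code_hd (code_tl l) div 2)) = p1 b))
     else
       (let b = n div 2 div 2 in \<not> odd (p1 b) \<and> \<not> odd (p2 b) \<and>
         (if odd n then \<not> p1 b = p2 b else p1 b = p2 b)))"

lemma decid_diagram_pred: "decid X 1 (\<lambda>xs. diagram_pred X (xs ! 0))"
  unfolding diagram_pred_def Let_def by (intro comput_intros; simp)

lemma code_Cons_decomp: "l \<noteq> 0 \<Longrightarrow> code_Cons (code_hd l) (code_tl l) = l"
  by (cases l) (simp_all add: code_hd_def code_tl_def)

lemma pr_p1_p2: "pr (p1 n) (p2 n) = n"
  by simp

lemma atomic_diagram_struc_of:
  "atomic_diagram lang2 (struc_of X) n \<longleftrightarrow> diagram_pred X n"
proof
  assume "atomic_diagram lang2 (struc_of X) n"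
  then obtain l where l: "wf_literal lang2 UNIV l" "literal_true (struc_of X) l" "n = literal_code l"
    by (auto simp: atomic_diagram_def struc_of_def)
  have atom: "wf_atom lang2 UNIV \<phi> \<Longrightarrow> diagram_pred X (2 * atom_code \<phi>) = atom_true (struc_of X) \<phi>
     \<and> diagram_pred X (Suc (2 * atom_code \<phi>)) = (\<not> atom_true (struc_of X) \<phi>)" for \<phi>
    by (auto simp: wf_atom_lang2 diagram_pred_def struc_of_def sum_encode_def Let_def)
  show "diagram_pred X n"
    using l atom by (cases l) (auto simp: sum_encode_def)
next
  assume D: "diagram_pred X n"
  define b where "b = n div 2 div 2"
  \<comment> \<open>The atom read off from \<open>n\<close>; its code is \<open>n div 2\<close>
    because \<open>diagram_pred\<close> rejects numbers that code no literal.\<close>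
  define \<phi> where "\<phi> = (if odd (n div 2)
    then Rel (p1 b) [Elem (code_hd (p2 b) div 2), Elem (code_hd (code_tl (p2 b)) div 2)]
    else Eq (Elem (p1 b div 2)) (Elem (p2 b div 2)))"
  have "atom_code \<phi> = n div 2"
  proof (cases "odd (n div 2)")
    case True
    let ?l = "p2 b"
    have *: "?l \<noteq> 0" "code_tl ?l \<noteq> 0" "code_tl (code_tl ?l) = 0"
      "even (code_hd ?l)" "even (code_hd (code_tl ?l))"
      using D True by (auto simp: diagram_pred_def Let_def b_def)
    then have "code_Cons (code_hd ?l) (code_Cons (code_hd (code_tl ?l)) 0) = ?l"
      using code_Cons_decomp[of ?l] code_Cons_decomp[of "code_tl ?l"] by simp
    then have "atom_code \<phi> = Suc (2 * pr (p1 b) ?l)"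
      using True * by (simp add: \<phi>_def sum_encode_def)
    then show ?thesis using True by (simp add: b_def)
  next
    case False
    then have "even (p1 b)" "even (p2 b)"
      using D by (auto simp: diagram_pred_def Let_def b_def)
    then have "atom_code \<phi> = 2 * pr (p1 b) (p2 b)"
      using False by (simp add: \<phi>_def sum_encode_def)
    then show ?thesis using False by (simp add: b_def)
  qed
  moreover have "wf_atom lang2 UNIV \<phi>" by (auto simp: \<phi>_def wf_atom_lang2)
  moreover have "atom_true (struc_of X) \<phi> \<longleftrightarrow> even n"
    using D by (auto simp: \<phi>_def b_def diagram_pred_def struc_of_def Let_def elim!: evenE split: if_splits)
  ultimately show "atomic_diagram lang2 (struc_of X) n"
    unfolding atomic_diagram_def
    by (intro exI[of _ "if odd n then Neg \<phi> else Pos \<phi>"]) (auto simp: struc_of_def sum_encode_def)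
qed

lemma diagram_reducible: "atomic_diagram lang2 (struc_of X) \<le>\<^sub>T X"
proof -
  have "atomic_diagram lang2 (struc_of X) = diagram_pred X"
    using atomic_diagram_struc_of by blast
  then show ?thesis
    using decid_diagram_pred[of X] by (simp add: turing_reducible_def decid_def computable_fromI)
qed

text \<open>Fibres over the same value are infinite sets of numbers and are matched by enumerating
  both in increasing order.\<close>

lemma bij_matching_fibres:
  fixes f g :: "nat \<Rightarrow> 'c"
  assumes "range f = range g"
    and f: "\<And>m. infinite {n. f n = f m}" and g: "\<And>m. infinite {n. g n = g m}"
  obtains h where "bij h" and "\<And>n. g (h n) = f n"
proof -
  have "\<exists>h. bij_betw h {n. f n = c} {n. g n = c}" if "c \<in> range f" for c
  proof -
    have "infinite {n. f n = c}" "infinite {n. g n = c}"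
      using that f g assms(1) by (auto, metis rangeE)
    then have "bij_betw (enumerate {n. f n = c}) UNIV {n. f n = c}"
      "bij_betw (enumerate {n. g n = c}) UNIV {n. g n = c}"
      by (simp_all add: bij_enumerate)
    then show ?thesis using bij_betw_trans bij_betw_inv_into by blast
  qed
  then obtain h where h: "\<And>c. c \<in> range f \<Longrightarrow> bij_betw (h c) {n. f n = c} {n. g n = c}"
    by metis
  show thesis
  proof
    have g_h: "g (h (f n) n) = f n" for n
      using h[of "f n"] by (auto simp: bij_betw_def)
    then show "g ((\<lambda>n. h (f n) n) n) = f n" for n by simp
    show "bij (\<lambda>n. h (f n) n)"
    proof (rule bijI)
      show "inj (\<lambda>n. h (f n) n)"
      proof (rule injI)
        fix m n assume eq: "h (f m) m = h (f n) n"
        then have "f m = f n" using g_h by metis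
        then show "m = n"
          using h[of "f n"] eq by (auto simp: bij_betw_def inj_on_def)
      qed
      show "surj (\<lambda>n. h (f n) n)"
      proof (rule surjI)
        fix m
        have "g m \<in> range f" using assms(1) by blast
        then have "m \<in> h (g m) ` {n. f n = g m}" using h[of "g m"] by (auto simp: bij_betw_def)
        then show "h (f (inv_into {n. f n = g m} (h (g m)) m)) (inv_into {n. f n = g m} (h (g m)) m) = m"
          by (metis (mono_tags, lifting) f_inv_into_f inv_into_into mem_Collect_eq)
      qed
    qed
  qed
qed

text \<open>Fibres are matched twice: first players with the same colour set, each of which occurs
  infinitely often, then the elements of the same colour within matched players.\<close>

lemma isomorphic_struc_of:
  assumes "range (colours X) = range (colours X')"
  shows "isomorphic lang2 (struc_of X) (struc_of X')"
proof -
  obtain h where h: "bij h" "\<And>x. colours X' (h x) = colours X x"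
    using bij_matching_fibres[OF assms] infinite_copies by metis
  have "\<exists>k. bij k \<and> (\<forall>v. colour X' (h x) (k v) = colour X x v)" for x
  proof -
    have "range (colour X x) = range (colour X' (h x))" by (simp add: range_colour h)
    moreover have "infinite {v. colour X x v = colour X x u}" for u
      using infinite_colour range_colour by blast
    moreover have "infinite {v. colour X' (h x) v = colour X' (h x) u}" for u
      using infinite_colour range_colour by blast
    ultimately show ?thesis using bij_matching_fibres by metis
  qed
  then obtain k where k: "\<And>x. bij (k x)" "\<And>x v. colour X' (h x) (k x v) = colour X x v"
    by metis
  define H where "H u = pr (h (p1 u)) (k (p1 u) (p2 u))" for u
  have "bij H"
  proof (rule bijI)
    show "inj H"
    proof (rule injI)
      fix u v assume "H u = H v"
      then have "h (p1 u) = h (p1 v)" "k (p1 u) (p2 u) = k (p1 v) (p2 v)"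
        by (simp_all add: H_def)
      then have "p1 u = p1 v" "p2 u = p2 v"
        using h(1) k(1) by (metis bij_is_inj injD)+
      then show "u = v" by (metis pr_p1_p2)
    qed
    show "surj H"
    proof (rule surjI)
      fix u
      have "h (inv h (p1 u)) = p1 u" using h(1) by (simp add: bij_is_surj surj_f_inv_f)
      moreover have "k x (inv (k x) (p2 u)) = p2 u" for x
        using k(1) by (simp add: bij_is_surj surj_f_inv_f)
      ultimately show "H (pr (inv h (p1 u)) (inv (k (inv h (p1 u))) (p2 u))) = u"
        by (simp add: H_def)
    qed
  qed
  moreover have "p1 (H u) = p1 (H v) \<longleftrightarrow> p1 u = p1 v" for u v
    using h(1) by (auto simp: H_def dest: bij_is_inj injD)
  moreover have "colour X' (p1 (H u)) (p2 (H v)) = colour X (p1 u) (p2 v)" if "p1 u = p1 v" for u v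
    using that by (simp add: H_def k)
  ultimately have "isomorphism lang2 H (struc_of X) (struc_of X')"
    by (auto simp: isomorphism_def lang2_def struc_of_def length_2_conv)
  then show ?thesis unfolding isomorphic_def by blast
qed

section \<open>Almost every real computes a copy\<close>

text \<open>No player is mentioned: a hit on any player of the board falls in its first round or in
  one of these, so countably many conditions define a typical real.\<close>

definition errors :: "(nat \<Rightarrow> bool) \<Rightarrow> nat \<Rightarrow> nat set" where
  "errors X n = {k. \<exists>t. killing (count_at n t) \<and> round_at n t = k \<and> victim (board n t) = block X k}"

definition typical :: "(nat \<Rightarrow> bool) \<Rightarrow> bool" where
  "typical X \<longleftrightarrow> (\<forall>n. finite (errors X n))"

lemma hit_cases:
  assumes "hit X x t" 
  shows "round_at (own_board x) t = round_at (own_board x) (start x) \<or>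
    round_at (own_board x) t \<in> errors X (own_board x)"
  using assms by (auto simp: hit_def played_def errors_def)

text \<open>Hits occur in finitely many rounds only, and a hit brings no mark beyond its round, so
  the number of marks attains a maximum.\<close>

lemma marks_bounded:
  assumes "typical X"
  obtains d s where "marks X x s = d" and "\<And>s. marks X x s \<le> d"
proof -
  let ?K = "insert (round_at (own_board x) (start x)) (errors X (own_board x))"
  have fin: "finite ?K" using assms by (simp add: typical_def)
  obtain B where B: "\<And>k. k \<in> ?K \<Longrightarrow> k < B"
    using fin finite_nat_set_iff_bounded[of ?K] by blast
  define m where "m = max (init_marks x) B"
  have hit: "Suc (round_at (own_board x) (start x + s)) \<le> m" if "hit X x (start x + s)" for s
  proof -
    have "round_at (own_board x) (start x + s) < B" using hit_cases[OF that] by (intro B) blast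
    then show ?thesis by (simp add: m_def)
  qed
  have "marks X x s \<le> m" for s
  proof (induction s)
    case 0
    show ?case by (simp add: m_def)
  next
    case (Suc s)
    then show ?case using hit[of s] by simp
  qed
  then have "finite (range (marks X x))"
    by (auto intro: finite_subset[of _ "{..m}"])
  then have mem: "Max (range (marks X x)) \<in> range (marks X x)"
    and le: "\<And>s. marks X x s \<le> Max (range (marks X x))"
    by simp_all
  from mem obtain s where "Max (range (marks X x)) = marks X x s" by (rule rangeE)
  then show thesis by (rule that[OF sym le])
qed

lemma count_at_dichotomy:
  obtains (stall) T where "\<And>t. T \<le> t \<Longrightarrow> count_at n t = count_at n T"
  | (run) "\<And>c. \<exists>t. c \<le> count_at n t"
proof (cases "\<exists>B. \<forall>t. count_at n t \<le> B")
  case True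
  then have "finite (range (count_at n))"
    by (auto simp: finite_nat_set_iff_bounded_le)
  then have "Max (range (count_at n)) \<in> range (count_at n)" by simp
  then obtain T where T: "Max (range (count_at n)) = count_at n T" by (rule rangeE)
  have "count_at n t = count_at n T" if "T \<le> t" for t
    using count_at_mono[OF that, of n] Max_ge[OF \<open>finite (range (count_at n))\<close>, of "count_at n t"] T
    by simp
  then show thesis by (rule stall)
next
  case False
  then have "\<exists>t. c \<le> count_at n t" for c
    unfolding not_ex not_all not_le using less_imp_le by blast
  then show thesis by (rule run)
qed

text \<open>The round is constant from \<open>T\<close> on and the marks from \<open>s0\<close> on,
  so \<open>holds\<close> has reached its limit at \<open>T + s0\<close>.\<close>

lemma colours_stall:
  assumes "own_board x = n" and T: "\<And>t. T \<le> t \<Longrightarrow> count_at n t = count_at n T"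
    and d: "marks X x s0 = d" "\<And>s. marks X x s \<le> d"
  shows "c \<in> colours X x \<longleftrightarrow> c = pr 0 n \<or>
    (p1 c = 1 \<and> (p1 (p2 c) < round_at n T \<or>
       p1 (p2 c) = round_at n T \<and> p2 (p2 c) = played X x (p1 (p2 c)))) \<or>
    (p1 c = 2 \<and> p2 c < d)"
proof -
  have late: "holds X x s c \<longleftrightarrow> c = pr 0 n \<or>
    (p1 c = 1 \<and> (p1 (p2 c) < round_at n T \<or>
       p1 (p2 c) = round_at n T \<and> p2 (p2 c) = played X x (p1 (p2 c)))) \<or>
    (p1 c = 2 \<and> p2 c < d)" if "T + s0 \<le> s" for s
  proof -
    have "s0 \<le> s" using that by simp
    then have "marks X x s = d" using d(2)[of s] marks_mono[of s0 s X x] d(1) by simp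
    moreover have "count_at n (start x + s) = count_at n T" by (rule T) (use that in simp)
    ultimately show ?thesis by (simp add: holds_def assms(1))
  qed
  have "c \<in> colours X x \<longleftrightarrow> holds X x (T + s0) c"
  proof
    assume "c \<in> colours X x"
    then obtain s where "holds X x s c" by (auto simp: colours_def)
    then have "holds X x (T + s0 + s) c" by (rule holds_mono) simp
    then show "holds X x (T + s0) c" using late[of "T + s0 + s"] late[of "T + s0"] by simp
  qed (auto simp: colours_def)
  then show ?thesis using late[of "T + s0"] by simp
qed

lemma round_at_unbounded:
  assumes "\<And>c. \<exists>t. c \<le> count_at n t" shows "\<exists>t. k \<le> round_at n t"
proof -
  obtain t where "2 * k + 1 \<le> count_at n t" using assms by blast
  then have "k \<le> round_at n t" by (simp add: round_of_def)
  then show ?thesis by blast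
qed

text \<open>Every round is eventually past, so all moves are granted, and only the marks distinguish
  the players of the board.\<close>

lemma colours_run:
  assumes "own_board x = n" and run: "\<And>c. \<exists>t. c \<le> count_at n t"
    and d: "marks X x s0 = d" "\<And>s. marks X x s \<le> d"
  shows "c \<in> colours X x \<longleftrightarrow> c = pr 0 n \<or> p1 c = 1 \<or> (p1 c = 2 \<and> p2 c < d)"
proof
  assume "c \<in> colours X x"
  then show "c = pr 0 n \<or> p1 c = 1 \<or> (p1 c = 2 \<and> p2 c < d)"
  proof -
    obtain s where "holds X x s c" using \<open>c \<in> colours X x\<close> by (auto simp: colours_def)
    then show ?thesis using d(2)[of s] by (auto simp: holds_def assms(1))
  qed
next
  assume c: "c = pr 0 n \<or> p1 c = 1 \<or> (p1 c = 2 \<and> p2 c < d)"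
  obtain t where "Suc (p1 (p2 c)) \<le> round_at n t" using round_at_unbounded[OF run] by blast
  then have "p1 (p2 c) < round_at n (start x + t)"
    using round_at_mono[of t "start x + t" n] by linarith
  then have "holds X x t c \<or> holds X x s0 c" using c d(1) by (auto simp: holds_def assms(1))
  then show "c \<in> colours X x" by (auto simp: colours_def)
qed

text \<open>The player \<open>x'\<close> starts late and receives the final number of marks of
  \<open>x\<close> at once; it remains to see that it gains no more.\<close>

lemma colours_of_typical:
  assumes X: "typical X" and X': "typical X'"
  shows "\<exists>x'. colours X x = colours X' x'"
proof -
  define n where "n = own_board x"
  obtain d s0 where d: "marks X x s0 = d" "\<And>s. marks X x s \<le> d"
    using marks_bounded[OF X] by blast
  show ?thesis
  proof (cases n rule: count_at_dichotomy)
    case (stall T)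
    \<comment> \<open>The game has reached its final round, in which \<open>x'\<close> copies the
      move of \<open>x\<close>.\<close>
    define x' where "x' = mk_player n d T (played X x (round_at n T))"
    have played': "played X' x' (round_at n T) = played X x (round_at n T)"
      by (simp add: played_def x'_def)
    have b1: "board n (T + s) = board n T" for s
      by (rule board_determined, rule stall) simp
    have b2: "board n (start x + T) = board n T"
      by (rule board_determined, rule stall) simp
    \<comment> \<open>A hit on \<open>x'\<close> would be one on \<open>x\<close> as well, whose
      marks would then already include that of the final round.\<close>
    have hit: "Suc (round_at n T) \<le> d" if "hit X' x' (T + s)" for s
    proof -
      have "hit X x (start x + T)"
        using that played' unfolding hit_def n_def[symmetric] b2 by (simp add: x'_def b1)
      then have "marks X x (Suc T) = max (marks X x T) (Suc (round_at n T))"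
        unfolding marks_Suc n_def[symmetric] b2 by (rule if_P)
      then show ?thesis using d(2)[of "Suc T"] by linarith
    qed
    have marks: "marks X' x' s = d" for s
    proof (induction s)
      case (Suc s)
      have own: "own_board x' = n" "start x' = T" by (simp_all add: x'_def)
      show ?case
      proof (cases "hit X' x' (T + s)")
        case True
        then have "marks X' x' (Suc s) = max d (Suc (round_at n T))"
          unfolding marks_Suc own Suc.IH b1 by (rule if_P)
        then show ?thesis using hit[OF True] by linarith
      next
        case False
        then show ?thesis unfolding marks_Suc own Suc.IH by (rule if_not_P)
      qed
    qed (simp add: x'_def)
    have c: "c \<in> colours X x \<longleftrightarrow> c = pr 0 n \<or>
      (p1 c = 1 \<and> (p1 (p2 c) < round_at n T \<or>
         p1 (p2 c) = round_at n T \<and> p2 (p2 c) = played X x (p1 (p2 c)))) \<or>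
      (p1 c = 2 \<and> p2 c < d)" for c
      by (rule colours_stall[OF n_def[symmetric] stall d])
    have c': "c \<in> colours X' x' \<longleftrightarrow> c = pr 0 n \<or>
      (p1 c = 1 \<and> (p1 (p2 c) < round_at n T \<or>
         p1 (p2 c) = round_at n T \<and> p2 (p2 c) = played X' x' (p1 (p2 c)))) \<or>
      (p1 c = 2 \<and> p2 c < d)" for c
    proof (rule colours_stall[of x' n T X' 0 d])
      show "own_board x' = n" by (simp add: x'_def)
      show "count_at n t = count_at n T" if "T \<le> t" for t by (rule stall[OF that])
    qed (rule marks, simp add: marks)
    have "c \<in> colours X x \<longleftrightarrow> c \<in> colours X' x'" for c
      unfolding c c' using played' by (cases "p1 (p2 c) = round_at n T") simp_all
    then show ?thesis by blast
  next
    case run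
    obtain B where B: "\<And>k. k \<in> errors X' n \<Longrightarrow> k < B"
      using X' finite_nat_set_iff_bounded[of "errors X' n"] unfolding typical_def by blast
    obtain T where T: "B \<le> round_at n T" using round_at_unbounded[OF run] by blast
    \<comment> \<open>At \<open>T\<close> all errors of \<open>X'\<close> are in past rounds, and
      the first move is the ordinary block, so \<open>x'\<close> is never hit from then on.\<close>
    define x' where "x' = mk_player n d T (block X' (round_at n T))"
    have played': "played X' x' k = block X' k" for k
      by (simp add: played_def x'_def)
    have no_hit: "\<not> hit X' x' (T + s)" for s
    proof
      assume "hit X' x' (T + s)"
      then have "round_at n (T + s) \<in> errors X' n"
        unfolding hit_def errors_def played' by (auto simp: x'_def)
      then show False using B[of "round_at n (T + s)"] T round_at_mono[of T "T + s" n] by simp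
    qed
    have marks: "marks X' x' s = d" for s
    proof (induction s)
      case (Suc s)
      have own: "own_board x' = n" "start x' = T" by (simp_all add: x'_def)
      show ?case unfolding marks_Suc own Suc.IH by (rule if_not_P) (rule no_hit)
    qed (simp add: x'_def)
    have c: "c \<in> colours X x \<longleftrightarrow> c = pr 0 n \<or> p1 c = 1 \<or> (p1 c = 2 \<and> p2 c < d)" for c
      by (rule colours_run[OF n_def[symmetric] run d])
    have c': "c \<in> colours X' x' \<longleftrightarrow> c = pr 0 n \<or> p1 c = 1 \<or> (p1 c = 2 \<and> p2 c < d)" for c
    proof (rule colours_run[of x' n X' 0 d])
      show "own_board x' = n" by (simp add: x'_def)
      show "\<exists>t. k \<le> count_at n t" for k by (rule run)
    qed (rule marks, simp add: marks)
    have "colours X x = colours X' x'" using c c' by blast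
    then show ?thesis by blast
  qed
qed

lemma isomorphic_of_typical:
  assumes "typical X" and "typical X'" shows "isomorphic lang2 (struc_of X) (struc_of X')"
proof -
  have "range (colours Y) \<subseteq> range (colours Z)" if "typical Y" "typical Z" for Y Z
  proof
    fix C assume "C \<in> range (colours Y)"
    then obtain y where "C = colours Y y" by (rule rangeE)
    then show "C \<in> range (colours Z)" using colours_of_typical[OF that, of y] by auto
  qed
  then show ?thesis using assms by (intro isomorphic_struc_of equalityI) auto
qed

section \<open>The coin measure of errors\<close>

lemma block_determines_bits:
  assumes "block X k = block Y k" and "i < k" shows "X (pr k i) = Y (pr k i)"
proof -
  let ?b = "\<lambda>X m. rec_nat 0 (\<lambda>i y. 2 * y + of_bool (X (pr k i))) m :: nat"
  have "?b X m = ?b Y m \<Longrightarrow> \<forall>i<m. X (pr k i) = Y (pr k i)" for m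
  proof (induction m)
    case (Suc m)
    have "2 * ?b X m + of_bool (X (pr k m)) = 2 * ?b Y m + of_bool (Y (pr k m))"
      using Suc.prems by simp
    then have "?b X m = ?b Y m \<and> X (pr k m) = Y (pr k m)"
      by (cases "X (pr k m)"; cases "Y (pr k m)") (auto, presburger+)
    then show ?case using Suc.IH by (auto simp: less_Suc_eq)
  qed simp
  then show ?thesis using assms by (simp add: block_def)
qed

interpretation coin: product_prob_space "\<lambda>_. measure_pmf (bernoulli_pmf (1 / 2))" "UNIV :: nat set"
  by unfold_locales

lemma space_coin [simp]: "space coin_measure = UNIV"
  by (simp add: coin_measure_def space_PiM PiE_UNIV_domain)

lemma cylinder_coin:
  assumes "finite J"
  shows "{X. \<forall>j\<in>J. X j = Z j} \<in> sets coin_measure"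
    and "measure coin_measure {X. \<forall>j\<in>J. X j = Z j} = (1 / 2) ^ card J"
proof -
  let ?M = "\<lambda>_ :: nat. measure_pmf (bernoulli_pmf (1 / 2))"
  have eq: "{X. \<forall>j\<in>J. X j = Z j} = prod_emb UNIV ?M J (Pi\<^sub>E J (\<lambda>j. {Z j}))"
    by (subst prod_emb_PiE) (auto simp: PiE_UNIV_domain split: if_splits)
  show "{X. \<forall>j\<in>J. X j = Z j} \<in> sets coin_measure"
    unfolding eq coin_measure_def using assms by (intro sets_PiM_I) auto
  have half: "measure_pmf.prob (bernoulli_pmf (1 / 2)) {z} = 1 / 2" for z
    by (cases z) (simp_all add: measure_pmf_single)
  show "measure coin_measure {X. \<forall>j\<in>J. X j = Z j} = (1 / 2) ^ card J"
    unfolding eq coin_measure_def using assms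
    by (subst coin.measure_PiM_emb) (simp_all add: half)
qed

text \<open>Either \<open>q\<close> is no value of the block, or exactly \<open>k\<close> bits are
  prescribed.\<close>

lemma block_event:
  shows "{X. block X k = q} \<in> sets coin_measure"
    and "measure coin_measure {X. block X k = q} \<le> (1 / 2) ^ k"
proof -
  let ?J = "pr k ` {..<k}"
  have card: "card ?J = k" by (subst card_image) (auto intro: inj_onI)
  have "{X. block X k = q} = {} \<or> (\<exists>Z. {X. block X k = q} = {X. \<forall>j\<in>?J. X j = Z j})"
  proof (cases "{X. block X k = q} = {}")
    case False
    then obtain Z where Z: "block Z k = q" by blast
    have agree: "block X k = q" if "\<forall>j\<in>?J. X j = Z j" for X
    proof -
      have "X (pr k i) = Z (pr k i)" if "i < k" for i
        using \<open>\<forall>j\<in>?J. X j = Z j\<close> that by blast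
      then have "m \<le> k \<Longrightarrow> rec_nat 0 (\<lambda>i y. 2 * y + of_bool (X (pr k i))) m
        = rec_nat (0 :: nat) (\<lambda>i y. 2 * y + of_bool (Z (pr k i))) m" for m
        by (induction m) simp_all
      then show ?thesis using Z by (simp add: block_def)
    qed
    have "{X. block X k = q} = {X. \<forall>j\<in>?J. X j = Z j}"
    proof (intro set_eqI iffI)
      fix X assume "X \<in> {X. block X k = q}"
      then have "block X k = block Z k" using Z by simp
      then have "X (pr k i) = Z (pr k i)" if "i < k" for i
        using that by (rule block_determines_bits)
      then show "X \<in> {X. \<forall>j\<in>?J. X j = Z j}" by blast
    qed (use agree in blast)
    then show ?thesis by blast
  qed simp
  then obtain Z where "{X. block X k = q} = {} \<or> {X. block X k = q} = {X. \<forall>j\<in>?J. X j = Z j}"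
    by blast
  then show "{X. block X k = q} \<in> sets coin_measure"
    "measure coin_measure {X. block X k = q} \<le> (1 / 2) ^ k"
    using cylinder_coin[of ?J Z] card by auto
qed

text \<open>As each round has at most one victim, an error in round \<open>k\<close> means one value
  of the block, of probability at most \<open>2^-k\<close>. These bounds are summable, so
  Borel--Cantelli applies to each of the countably many boards.\<close>

lemma AE_typical: "AE X in coin_measure. typical X"
proof -
  interpret prob_space coin_measure
    unfolding coin_measure_def by (rule coin.P.prob_space_axioms)
  have "AE X in coin_measure. finite (errors X n)" for n
  proof -
    define A where "A k = {X. k \<in> errors X n}" for k
    have A: "A k \<in> sets coin_measure \<and> measure coin_measure (A k) \<le> (1 / 2) ^ k" for k
    proof (cases "\<exists>t. killing (count_at n t) \<and> round_at n t = k")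
      case True
      then obtain t where t: "killing (count_at n t)" "round_at n t = k" by blast
      then have "A k = {X. block X k = victim (board n t)}"
      proof (intro set_eqI iffI)
        fix X assume "X \<in> A k"
        then obtain t' where t': "killing (count_at n t')" "round_at n t' = k"
          "victim (board n t') = block X k" by (auto simp: A_def errors_def)
        have "victim (board n t) = victim (board n t')"
          by (rule victim_unique) (use t t' in simp_all)
        then show "X \<in> {X. block X k = victim (board n t)}" using t'(3) by simp
      next
        fix X assume "X \<in> {X. block X k = victim (board n t)}"
        then have "killing (count_at n t) \<and> round_at n t = k \<and> victim (board n t) = block X k"
          using t by simp
        then show "X \<in> A k" unfolding A_def errors_def by blast
      qed
      then show ?thesis using block_event by simp
    next
      case False
      then have "A k = {}" by (auto simp: A_def errors_def)
      then show ?thesis by simp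
    qed
    have "summable (\<lambda>k. measure coin_measure (A k))"
      by (rule summable_comparison_test'[of "\<lambda>k. (1 / 2) ^ k" 0]) (use A in auto)
    then have "AE X in coin_measure. eventually (\<lambda>k. X \<in> space coin_measure - A k) sequentially"
      using A by (intro borel_cantelli_AE1) (auto simp: emeasure_eq_measure)
    then show ?thesis
    proof eventually_elim
      case (elim X)
      then obtain K where "\<And>k. K \<le> k \<Longrightarrow> k \<notin> errors X n"
        by (auto simp: eventually_sequentially A_def)
      then have "errors X n \<subseteq> {..<K}" by (meson lessThan_iff not_le subsetI)
      then show ?case using finite_subset by blast
    qed
  qed
  then show ?thesis unfolding typical_def by (simp add: AE_all_countable)
qed

lemma typical_exists: "\<exists>X. typical X"
proof -
  interpret prob_space coin_measure
    unfolding coin_measure_def by (rule coin.P.prob_space_axioms)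
  have "AE X in coin_measure. \<exists>Y. typical Y"
    by (rule eventually_mono[OF AE_typical]) blast
  then show ?thesis by simp
qed

lemma co_nullI:
  assumes "\<And>X. typical X \<Longrightarrow> X \<in> S" shows "co_null S"
proof -
  from AE_typical obtain N where N: "{X \<in> space coin_measure. \<not> typical X} \<subseteq> N"
    "emeasure coin_measure N = 0" "N \<in> sets coin_measure" by (rule AE_E)
  then have "- S \<subseteq> N" using assms by auto
  moreover have "N \<in> null_sets (completion coin_measure)"
    using N(2,3) by (intro null_sets_completionI null_setsI)
  ultimately show ?thesis
    unfolding co_null_def null_def by (meson null_sets_completion_subset)
qed

section \<open>Meagre sets in Cantor space\<close>

lemma nowhere_dense_subset:
  assumes "nowhere_dense T" and "S \<subseteq> T" shows "nowhere_dense S"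
proof -
  have "interior (closure S) \<subseteq> interior (closure T)"
    by (rule interior_mono[OF closure_mono[OF assms(2)]])
  then show ?thesis using assms(1) by (simp add: nowhere_dense_def)
qed

text \<open>\<open>meagre\<close> asks for equality with the union, so the nowhere dense sets are
  intersected with \<open>S\<close>.\<close>

lemma meagre_subset:
  assumes "meagre T" and "S \<subseteq> T" shows "meagre S"
proof -
  obtain \<F> where F: "countable \<F>" "\<And>A. A \<in> \<F> \<Longrightarrow> nowhere_dense A" "T = \<Union>\<F>"
    using assms(1) unfolding meagre_def by blast
  have "countable ((\<lambda>A. A \<inter> S) ` \<F>)" using F(1) by simp
  moreover have "nowhere_dense A" if "A \<in> (\<lambda>A. A \<inter> S) ` \<F>" for A
  proof -
    from that obtain B where B: "A = B \<inter> S" "B \<in> \<F>" by (rule imageE)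
    show ?thesis unfolding B(1) by (rule nowhere_dense_subset[OF F(2)[OF B(2)]]) simp
  qed
  moreover have "S = \<Union>((\<lambda>A. A \<inter> S) ` \<F>)" using F(3) assms(2) by auto
  ultimately show ?thesis unfolding meagre_def by (intro exI[of _ "(\<lambda>A. A \<inter> S) ` \<F>"]) simp
qed

lemma meagre_nowhere_dense: "nowhere_dense S \<Longrightarrow> meagre S"
  unfolding meagre_def by (rule exI[of _ "{S}"]) simp

lemma meagre_UN:
  assumes "\<And>i :: nat. meagre (S i)" shows "meagre (\<Union>i. S i)"
proof -
  have "\<forall>i. \<exists>\<F>. countable \<F> \<and> (\<forall>T\<in>\<F>. nowhere_dense T) \<and> S i = \<Union>\<F>"
    using assms unfolding meagre_def by blast
  from choice[OF this] obtain \<F>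
    where F: "\<forall>i. countable (\<F> i) \<and> (\<forall>T\<in>\<F> i. nowhere_dense T) \<and> S i = \<Union>(\<F> i)" ..
  have "countable (\<Union>i. \<F> i)" using F by simp
  moreover have "(\<Union>i. S i) = \<Union>(\<Union>i. \<F> i)" using F by auto
  moreover have "\<forall>T\<in>(\<Union>i. \<F> i). nowhere_dense T" using F by simp
  ultimately show ?thesis unfolding meagre_def by (intro exI[of _ "\<Union>i. \<F> i"]) simp
qed

lemma meagre_empty: "meagre {}"
  unfolding meagre_def by (rule exI[of _ "{}"]) simp

lemma open_cyl: "open (cyl \<rho>)"
proof -
  have "open {b}" for b :: bool
  proof -
    have "{b} = - {\<not> b}" by auto
    then show ?thesis by (metis closed_singleton open_Compl)
  qed
  then have "open {f :: nat \<Rightarrow> bool. \<forall>i\<in>{..<p1 \<rho>}. f (id i) \<in> {bit (p2 \<rho>) i}}"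
    by (intro product_topology_basis') simp_all
  then show ?thesis by (simp add: cyl_def Ball_def)
qed

lemma open_contains_cyl:
  assumes "open U" and "Y \<in> U" obtains \<rho> where "Y \<in> cyl \<rho>" and "cyl \<rho> \<subseteq> U"
proof -
  have "openin (product_topology (\<lambda>i :: nat. euclidean :: bool topology) UNIV) U"
    using assms(1) by (simp add: open_fun_def)
  from product_topology_open_contains_basis[OF this assms(2)]
  have "\<exists>V. Y \<in> (\<Pi>\<^sub>E i\<in>UNIV. V i) \<and> finite {i. V i \<noteq> UNIV} \<and> (\<Pi>\<^sub>E i\<in>UNIV. V i) \<subseteq> U"
    by auto
  then obtain V :: "nat \<Rightarrow> bool set" where V: "Y \<in> (\<Pi>\<^sub>E i\<in>UNIV. V i)" "finite {i. V i \<noteq> UNIV}"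
    "(\<Pi>\<^sub>E i\<in>UNIV. V i) \<subseteq> U"
    by blast
  obtain m where m: "\<And>i. V i \<noteq> UNIV \<Longrightarrow> i < m"
    using V(2) finite_nat_set_iff_bounded[of "{i. V i \<noteq> UNIV}"] by blast
  obtain \<rho> where \<rho>: "p1 \<rho> = m" "Y \<in> cyl \<rho>" using obtain_prefix by blast
  have "cyl \<rho> \<subseteq> U"
  proof
    fix Z assume Z: "Z \<in> cyl \<rho>"
    have "Z i \<in> V i" for i
    proof (cases "V i = UNIV")
      case False
      then have "Z i = Y i" using m[of i] Z \<rho> by (simp add: cyl_def)
      then show ?thesis using V(1) by (auto simp: PiE_UNIV_domain)
    qed simp
    then show "Z \<in> U" using V(3) by (auto simp: PiE_UNIV_domain)
  qed
  then show thesis using \<rho>(2) that by blast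
qed

text \<open>Cylinders form a base, and an open cylinder that misses \<open>S\<close> misses its
  closure.\<close>

lemma nowhere_denseI:
  assumes "\<And>\<sigma>. \<exists>\<rho>. extends \<rho> \<sigma> \<and> cyl \<rho> \<inter> S = {}" shows "nowhere_dense S"
proof -
  have False if Y: "Y \<in> interior (closure S)" for Y
  proof -
    obtain \<sigma> where \<sigma>: "cyl \<sigma> \<subseteq> interior (closure S)"
      using open_contains_cyl[OF open_interior Y] by blast
    obtain \<rho> where \<rho>: "extends \<rho> \<sigma>" "cyl \<rho> \<inter> S = {}" using assms by blast
    have "cyl \<rho> \<inter> closure S = {}"
      using open_Int_closure_eq_empty[OF open_cyl, of \<rho> S] \<rho>(2) by simp
    moreover have "cyl \<rho> \<subseteq> closure S"
      using cyl_mono[OF \<rho>(1)] \<sigma> interior_subset[of "closure S"] by (meson subset_trans)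
    ultimately show False using cyl_nonempty[of \<rho>] by blast
  qed
  then show ?thesis unfolding nowhere_dense_def by blast
qed

text \<open>There are countably many cylinders. Once the meagre traces of \<open>S\<close> on them
  are removed, the rest is nowhere dense.\<close>

lemma meagre_locally:
  assumes "\<And>\<sigma>. \<exists>\<rho>. extends \<rho> \<sigma> \<and> meagre (cyl \<rho> \<inter> S)" shows "meagre S"
proof -
  define P where "P \<rho> = (if meagre (cyl \<rho> \<inter> S) then cyl \<rho> \<inter> S else {})" for \<rho>
  define R where "R = S - (\<Union>\<rho>. P \<rho>)"
  have "meagre (P \<rho>)" for \<rho> by (simp add: P_def meagre_empty)
  then have "meagre (\<Union>\<rho>. P \<rho>)" by (rule meagre_UN)
  moreover have "nowhere_dense R"
  proof (rule nowhere_denseI)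
    fix \<sigma>
    obtain \<rho> where \<rho>: "extends \<rho> \<sigma>" "meagre (cyl \<rho> \<inter> S)" using assms by blast
    then have "cyl \<rho> \<inter> S = P \<rho>" by (simp add: P_def)
    then have "cyl \<rho> \<inter> R = {}" unfolding R_def by blast
    then show "\<exists>\<rho>. extends \<rho> \<sigma> \<and> cyl \<rho> \<inter> R = {}" using \<rho>(1) by blast
  qed
  then have "meagre R" by (rule meagre_nowhere_dense)
  ultimately have "meagre (\<Union>i :: nat. if i = 0 then R else (\<Union>\<rho>. P \<rho>))"
    by (intro meagre_UN) simp
  moreover have "S \<subseteq> (\<Union>i :: nat. if i = 0 then R else (\<Union>\<rho>. P \<rho>))"
  proof
    fix Y assume "Y \<in> S"
    then have "Y \<in> (if (0 :: nat) = 0 then R else (\<Union>\<rho>. P \<rho>)) \<or>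
      Y \<in> (if (1 :: nat) = 0 then R else (\<Union>\<rho>. P \<rho>))"
      by (auto simp: R_def)
    then show "Y \<in> (\<Union>i :: nat. if i = 0 then R else (\<Union>\<rho>. P \<rho>))" by blast
  qed
  ultimately show ?thesis by (rule meagre_subset)
qed

section \<open>Generic reals compute no copy\<close>

text \<open>Countably many such sets cover the spectrum, so each program is treated
  separately.\<close>

definition copies :: "nat \<Rightarrow> nat struc \<Rightarrow> (nat \<Rightarrow> bool) set" where
  "copies e M = {Y. \<exists>p N. prog_code p = e \<and> isomorphic lang2 M N \<and>
     (\<forall>n. evaluates Y p [n] (of_bool (atomic_diagram lang2 N n)))}"

lemma atomic_diagram_lit:
  "atomic_diagram lang2 N (lit c a b) \<longleftrightarrow>
    a \<in> universe N \<and> b \<in> universe N \<and> interp_rel N c [a, b]"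
proof
  assume "atomic_diagram lang2 N (lit c a b)"
  then obtain l where l: "wf_literal lang2 (universe N) l" "literal_true N l"
    "literal_code (Pos (Rel c [Elem a, Elem b])) = literal_code l"
    by (auto simp: atomic_diagram_def lit_def)
  then obtain \<phi> where \<phi>: "l = Pos \<phi>" "wf_atom lang2 (universe N) \<phi>" "atom_true N \<phi>"
    "atom_code (Rel c [Elem a, Elem b]) = atom_code \<phi>"
    by (cases l) (auto simp: sum_encode_eq simp del: atom_code.simps)
  then show "a \<in> universe N \<and> b \<in> universe N \<and> interp_rel N c [a, b]"
    by (auto simp: wf_atom_lang2 sum_encode_eq)
next
  assume "a \<in> universe N \<and> b \<in> universe N \<and> interp_rel N c [a, b]"
  then show "atomic_diagram lang2 N (lit c a b)"
    unfolding atomic_diagram_def lit_def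
    by (intro exI[of _ "Pos (Rel c [Elem a, Elem b])"]) (simp add: wf_atom_lang2 del: wf_atom.simps)
qed

text \<open>The interface to a copy computed by \<open>Y\<close>. \<open>A\<close> is its universe,
  and \<open>col a\<close> is the set of colours occurring in relations \<open>R c a b\<close>,
  which is the colour set of the player owning \<open>a\<close>. Acceptance on prefixes of
  \<open>Y\<close> enumerates these sets.\<close>

lemma copies_element:
  assumes "Y \<in> copies e (struc_of X)"
  obtains A and col :: "nat \<Rightarrow> nat set"
  where "\<And>a. a \<in> A \<Longrightarrow> \<exists>x. col a = colours X x"
    and "\<And>x. \<exists>a\<in>A. col a = colours X x"
    and "\<And>\<rho> c a b s. Y \<in> cyl \<rho> \<Longrightarrow> accepts e \<rho> (lit c a b) s \<Longrightarrow> a \<in> A \<and> c \<in> col a"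
    and "\<And>a c. a \<in> A \<Longrightarrow> c \<in> col a \<Longrightarrow>
      \<exists>b s m. \<forall>\<rho>. m \<le> p1 \<rho> \<longrightarrow> Y \<in> cyl \<rho> \<longrightarrow> accepts e \<rho> (lit c a b) s"
proof -
  obtain p N h where p: "prog_code p = e"
    "\<And>n. evaluates Y p [n] (of_bool (atomic_diagram lang2 N n))"
    and h: "isomorphism lang2 h (struc_of X) N"
    using assms unfolding copies_def isomorphic_def by blast
  have univ: "universe N = range h"
    using h by (auto simp: isomorphism_def struc_of_def bij_betw_def)
  have rel: "interp_rel N c [h u, h v] \<longleftrightarrow> p1 u = p1 v \<and> colour X (p1 u) (p2 v) = c" for c u v
  proof -
    have "\<forall>R xs. length xs = 2 \<longrightarrow> interp_rel N R (map h xs) = interp_rel (struc_of X) R xs"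
      using h unfolding isomorphism_def by (simp add: lang2_def struc_of_def)
    from spec[OF spec[OF this, of c], of "[u, v]"] show ?thesis by (simp add: struc_of_def)
  qed
  define col where "col a = {c. \<exists>b\<in>universe N. interp_rel N c [a, b]}" for a
  have col: "col (h u) = colours X (p1 u)" for u
  proof
    show "col (h u) \<subseteq> colours X (p1 u)"
      using range_colour[of X "p1 u"] by (auto simp: col_def univ rel)
    show "colours X (p1 u) \<subseteq> col (h u)"
    proof
      fix c assume "c \<in> colours X (p1 u)"
      then have "c \<in> range (colour X (p1 u))" by (simp only: range_colour)
      then obtain v where "c = colour X (p1 u) v" by (rule rangeE)
      then have "interp_rel N c [h u, h (pr (p1 u) v)]" by (simp add: rel)
      then show "c \<in> col (h u)" by (auto simp: col_def univ)
    qed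
  qed
  show thesis
  proof (rule that[of "universe N" col])
    show "\<exists>x. col a = colours X x" if a: "a \<in> universe N" for a
    proof -
      from a obtain u where "a = h u" unfolding univ by (rule rangeE)
      then have "col a = colours X (p1 u)" using col by simp
      then show ?thesis ..
    qed
    show "\<exists>a\<in>universe N. col a = colours X x" for x
    proof
      show "col (h (pr x 0)) = colours X x" by (simp add: col)
      show "h (pr x 0) \<in> universe N" by (simp add: univ)
    qed
    show "a \<in> universe N \<and> c \<in> col a" if "Y \<in> cyl \<rho>" "accepts e \<rho> (lit c a b) s" for \<rho> c a b s
    proof -
      have "of_bool (atomic_diagram lang2 N (lit c a b)) = (1 :: nat)"
        by (rule accepts_sound[OF p(2)]) (use that p(1) in simp_all)
      then have "atomic_diagram lang2 N (lit c a b)" by (simp only: of_bool_eq_1_iff)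
      then show ?thesis by (auto simp: atomic_diagram_lit col_def)
    qed
    show "\<exists>b s m. \<forall>\<rho>. m \<le> p1 \<rho> \<longrightarrow> Y \<in> cyl \<rho> \<longrightarrow> accepts e \<rho> (lit c a b) s"
      if a: "a \<in> universe N" and c: "c \<in> col a" for a c
    proof -
      obtain b where "b \<in> universe N" "interp_rel N c [a, b]" using c by (auto simp: col_def)
      then have "atomic_diagram lang2 N (lit c a b)" using a by (simp add: atomic_diagram_lit)
      then have "evaluates Y p [lit c a b] 1" using p(2)[of "lit c a b"] by simp
      then show ?thesis
      proof (rule accepts_complete)
        fix s m
        assume "\<And>\<rho>. m \<le> p1 \<rho> \<Longrightarrow> Y \<in> cyl \<rho> \<Longrightarrow> accepts (prog_code p) \<rho> (lit c a b) s"
        then show ?thesis unfolding p(1) by blast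
      qed
    qed
  qed
qed

lemma tag_in_colours: "pr 0 (own_board x) \<in> colours X x"
  by (simp add: colours_def holds_def)

lemma own_board_unique: "pr 0 n \<in> colours X x \<Longrightarrow> own_board x = n"
  by (auto simp: colours_def holds_def)

text \<open>At stage \<open>start x + T\<close> the round is either current, and the player has its
  move, or past, and every move is granted.\<close>

lemma column_in_colours: "\<exists>r. pr 1 (pr (round_at (own_board x) T) r) \<in> colours X x"
proof -
  have "round_at (own_board x) T \<le> round_at (own_board x) (start x + T)"
    by (rule round_at_mono) simp
  then have "holds X x T (pr 1 (pr (round_at (own_board x) T)
      (played X x (round_at (own_board x) T))))"
    by (auto simp: holds_def)
  then show ?thesis unfolding colours_def by blast
qed

text \<open>On a stalled board the round of the victim never becomes past, so the move was played
  and not merely granted; hence late stages are hits.\<close>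

lemma mark_in_colours:
  assumes own: "own_board x = n" and T: "\<And>t. T \<le> t \<Longrightarrow> count_at n t = count_at n T"
    and "killing (count_at n T)"
    and "pr 1 (pr (round_at n T) (victim (board n T))) \<in> colours X x"
  shows "pr 2 (round_at n T) \<in> colours X x"
proof -
  obtain s where s: "holds X x s (pr 1 (pr (round_at n T) (victim (board n T))))"
    using assms(4) by (auto simp: colours_def)
  have b: "board n (start x + (T + s)) = board n T"
    by (rule board_determined, rule T) simp
  have "holds X x (T + s) (pr 1 (pr (round_at n T) (victim (board n T))))"
    by (rule holds_mono[OF s]) simp
  then have "victim (board n T) = played X x (round_at n T)"
    unfolding holds_def own b by simp
  then have "hit X x (start x + (T + s))"
    unfolding hit_def own b using assms(3) by simp
  then have "marks X x (Suc (T + s)) = max (marks X x (T + s)) (Suc (round_at n T))"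
    unfolding marks_Suc own b by (rule if_P)
  then have "round_at n T < marks X x (Suc (T + s))" by linarith
  then have "holds X x (Suc (T + s)) (pr 2 (round_at n T))" by (simp add: holds_def)
  then show ?thesis unfolding colours_def by blast
qed

lemma marks_in_colours_bounded:
  assumes "typical X" shows "\<exists>d. \<forall>j. pr 2 j \<in> colours X x \<longrightarrow> j < d"
proof -
  obtain d where d: "\<And>s. marks X x s \<le> d" using marks_bounded[OF assms] by blast
  have "j < d" if j: "pr 2 j \<in> colours X x" for j
  proof -
    obtain s where "j < marks X x s" using j by (auto simp: colours_def holds_def)
    then show ?thesis using d[of s] by simp
  qed
  then show ?thesis by blast
qed

section \<open>The history of a board\<close>

lemma stall_no_success:
  assumes T: "\<And>t. T \<le> t \<Longrightarrow> count_at n t = count_at n T"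
  shows "\<not> succeeds n (board n T) \<rho> a b s r"
proof
  assume succ: "succeeds n (board n T) \<rho> a b s r"
  \<comment> \<open>\<open>p1 t\<close> is the candidate and \<open>t\<close> is at least
    \<open>T\<close>, so the candidate is tried after the stall.\<close>
  define t where "t = pr (pr \<rho> (pr a (pr b (pr s r)))) T"
  have "T \<le> t" by (simp add: t_def le_prod_encode_2)
  then have "board n t = board n T" by (rule board_determined[OF T])
  then have "counter (board n (Suc t)) = Suc (count_at n T)"
    using succ by (simp add: advance_def t_def)
  moreover have "count_at n (Suc t) = count_at n T" by (rule T) (use \<open>T \<le> t\<close> in simp)
  ultimately show False by simp
qed

lemma board_reached:
  assumes "count_at n t = Suc c"
  obtains t' \<rho> a b s r where "count_at n t' = c" and "succeeds n (board n t') \<rho> a b s r"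
    and "board n t = mk_state (Suc c) (new_watched (board n t') a)
      (if c = 0 then \<rho> else base (board n t')) r \<rho>"
proof -
  have "\<exists>t'. count_at n t' = c \<and> count_at n (Suc t') = Suc c"
    using assms
  proof (induction t)
    case 0
    then show ?case by (simp add: counter_def)
  next
    case (Suc t)
    have "count_at n (Suc t) = count_at n t \<or> count_at n (Suc t) = Suc (count_at n t)"
      using advance_cases[of n "board n t" "p1 t"] by auto
    then show ?case
    proof
      assume "count_at n (Suc t) = count_at n t"
      then show ?thesis using Suc by simp
    next
      assume *: "count_at n (Suc t) = Suc (count_at n t)"
      then have "count_at n t = c" using Suc.prems by simp
      then show ?thesis using Suc.prems by blast
    qed
  qed
  then obtain t' where t': "count_at n t' = c" "count_at n (Suc t') = Suc c" by blast
  have eq: "board n t = board n (Suc t')" by (rule board_determined) (simp only: assms t')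
  define j where "j = p1 t'"
  have succ: "succeeds n (board n t') (p1 j) (p1 (p2 j)) (p1 (p2 (p2 j))) (p1 (p2 (p2 (p2 j))))
      (p2 (p2 (p2 (p2 j))))"
  proof (rule ccontr)
    assume "\<not> ?thesis"
    then have "board n (Suc t') = board n t'" by (simp add: advance_def j_def)
    then show False using t' by simp
  qed
  then have new: "board n (Suc t') = mk_state (Suc c) (new_watched (board n t') (p1 (p2 j)))
      (if c = 0 then p1 j else base (board n t')) (p2 (p2 (p2 (p2 j)))) (p1 j)"
    unfolding board_Suc advance_def j_def[symmetric] t'(1) by (rule if_P)
  show thesis by (rule that[OF t'(1) succ trans[OF eq new]])
qed

text \<open>The invariant after the first success. It commits copies computed below
  \<open>base\<close> to the tag of the watched element, and those below \<open>recent\<close> to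
  the move being killed.\<close>

definition sound_state :: "nat \<Rightarrow> nat \<Rightarrow> bool" where
  "sound_state n st \<longleftrightarrow> extends (base st) (p2 n) \<and> extends (recent st) (base st) \<and>
     (\<exists>b s. accepts (p1 n) (base st) (lit (pr 0 n) (watched st) b) s) \<and>
     (killing (counter st) \<longrightarrow> (\<exists>b s. accepts (p1 n) (recent st)
        (lit (pr 1 (pr (round_of (counter st)) (victim st))) (watched st) b) s))"

lemma round_of_simps: "odd c \<Longrightarrow> round_of (Suc c) = round_of c"
  by (auto simp: round_of_def elim!: oddE)

lemma board_sound: "count_at n t = Suc c \<Longrightarrow> sound_state n (board n t)"
proof (induction c arbitrary: t)
  case 0
  obtain t' \<rho> a b s r where *: "count_at n t' = 0" "succeeds n (board n t') \<rho> a b s r"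
    "board n t = mk_state (Suc 0) (new_watched (board n t') a)
      (if 0 = (0 :: nat) then \<rho> else base (board n t')) r \<rho>"
    using board_reached[OF 0] .
  have "extends \<rho> (p2 n)" "accepts (p1 n) \<rho> (lit (pr 0 n) a b) s"
    using *(2) by (simp_all add: succeeds_def target_def wanted_def new_watched_def *(1))
  then show ?case
    unfolding sound_state_def *(3) by (auto simp: new_watched_def *(1) extends_refl killing_def)
next
  case (Suc c)
  obtain t' \<rho> a b s r where *: "count_at n t' = Suc c" "succeeds n (board n t') \<rho> a b s r"
    "board n t = mk_state (Suc (Suc c)) (new_watched (board n t') a)
      (if Suc c = 0 then \<rho> else base (board n t')) r \<rho>"
    using board_reached[OF Suc.prems] .
  have IH: "sound_state n (board n t')" by (rule Suc.IH[OF *(1)])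
  have st: "board n t = mk_state (Suc (Suc c)) (watched (board n t')) (base (board n t')) r \<rho>"
    using *(3) by (simp add: new_watched_def *(1))
  have acc: "accepts (p1 n) \<rho> (lit (wanted n (board n t') r) (watched (board n t')) b) s"
    using *(2) by (simp add: succeeds_def new_watched_def *(1))
  have "extends \<rho> (target n (board n t'))" using *(2) by (simp add: succeeds_def)
  moreover have "extends (target n (board n t')) (base (board n t'))"
    using IH by (simp add: target_def sound_state_def *(1) extends_refl)
  ultimately have ext: "extends \<rho> (base (board n t'))" by (rule extends_trans)
  have "\<exists>b s. accepts (p1 n) \<rho>
      (lit (pr 1 (pr (round_of (Suc (Suc c))) r)) (watched (board n t')) b) s"
    if "killing (Suc (Suc c))"
  proof -
    have "odd (Suc c)" using that by (simp add: killing_def)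
    then have "wanted n (board n t') r = pr 1 (pr (round_of (Suc (Suc c))) r)"
      by (simp add: wanted_def *(1) round_of_simps)
    then show ?thesis using acc by auto
  qed
  then show ?case
    using IH ext unfolding sound_state_def st by simp
qed

lemma watched_const:
  assumes "count_at n t = Suc c" and "count_at n t1 = Suc 0"
  shows "watched (board n t) = watched (board n t1) \<and> base (board n t) = base (board n t1)"
  using assms(1)
proof (induction c arbitrary: t)
  case 0
  then have "board n t = board n t1" by (intro board_determined) (simp only: assms(2))
  then show ?case by simp
next
  case (Suc c)
  obtain t' \<rho> a b s r where *: "count_at n t' = Suc c" "succeeds n (board n t') \<rho> a b s r"
    "board n t = mk_state (Suc (Suc c)) (new_watched (board n t') a)
      (if Suc c = 0 then \<rho> else base (board n t')) r \<rho>"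
    using board_reached[OF Suc.prems] .
  then show ?case using Suc.IH[OF *(1)] by (simp add: new_watched_def)
qed

text \<open>Counter \<open>2k + 3\<close> means that round \<open>k\<close> is over: its kill was
  found on an extension of \<open>p1 k\<close>, and its mark on an extension of that.\<close>

lemma mark_reached:
  assumes "count_at n t = Suc (Suc (Suc (2 * k)))" and t1: "count_at n t1 = Suc 0"
    and "extends (p1 k) (base (board n t1))"
  shows "\<exists>\<rho> b s. extends \<rho> (p1 k) \<and> accepts (p1 n) \<rho> (lit (pr 2 k) (watched (board n t1)) b) s"
proof -
  obtain t' \<rho> a b s r where *: "count_at n t' = Suc (Suc (2 * k))" "succeeds n (board n t') \<rho> a b s r"
    using board_reached[OF assms(1)] by metis
  obtain t2 \<rho>2 a2 b2 s2 r2 where **: "count_at n t2 = Suc (2 * k)"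
    "succeeds n (board n t2) \<rho>2 a2 b2 s2 r2"
    "board n t' = mk_state (Suc (Suc (2 * k))) (new_watched (board n t2) a2)
      (if Suc (2 * k) = 0 then \<rho>2 else base (board n t2)) r2 \<rho>2"
    using board_reached[OF *(1)] .
  have "base (board n t2) = base (board n t1)" using watched_const[OF **(1) t1] by simp
  then have "extends \<rho>2 (p1 k)"
    using **(2) assms(3) by (simp add: succeeds_def target_def **(1) round_of_def)
  moreover have "extends \<rho> \<rho>2"
    using *(2) by (simp add: succeeds_def target_def *(1)) (simp add: **(3))
  moreover have "watched (board n t') = watched (board n t1)" using watched_const[OF *(1) t1] by simp
  then have "accepts (p1 n) \<rho> (lit (pr 2 k) (watched (board n t1)) b) s"
    using *(2) by (simp add: succeeds_def wanted_def new_watched_def *(1) round_of_def)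
  ultimately show ?thesis using extends_trans by blast
qed

section \<open>The two outcomes of a board\<close>

lemma prefix_extending:
  assumes "Y \<in> cyl \<sigma>"
  obtains \<rho> where "m \<le> p1 \<rho>" and "Y \<in> cyl \<rho>" and "extends \<rho> \<sigma>"
proof -
  obtain \<rho> where \<rho>: "p1 \<rho> = max m (p1 \<sigma>)" "Y \<in> cyl \<rho>" using obtain_prefix by blast
  show thesis
    by (rule that[OF _ \<rho>(2) extends_if_cyl[OF \<rho>(2) assms]]) (simp_all add: \<rho>(1))
qed

text \<open>A copy computed below \<open>target\<close> would contain the fact the board waits for,
  and some prefix would accept it, contradicting the stall.\<close>

lemma copies_stall:
  assumes T: "\<And>t. T \<le> t \<Longrightarrow> count_at (pr e \<sigma>) t = count_at (pr e \<sigma>) T"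
  shows "cyl (target (pr e \<sigma>) (board (pr e \<sigma>) T)) \<inter> copies e (struc_of X) = {}"
proof (rule ccontr)
  define n where "n = pr e \<sigma>"
  define st where "st = board n T"
  have e: "p1 n = e" by (simp add: n_def)
  assume "\<not> ?thesis"
  then obtain Y where Y: "Y \<in> cyl (target n st)" "Y \<in> copies e (struc_of X)"
    by (auto simp: n_def st_def)
  obtain A col where el: "\<And>a. a \<in> A \<Longrightarrow> \<exists>x. col a = colours X x"
    and surj: "\<And>x. \<exists>a\<in>A. col a = colours X x"
    and sound: "\<And>\<rho> c a b s. Y \<in> cyl \<rho> \<Longrightarrow> accepts e \<rho> (lit c a b) s \<Longrightarrow> a \<in> A \<and> c \<in> col a"
    and complete: "\<And>a c. a \<in> A \<Longrightarrow> c \<in> col a \<Longrightarrow>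
      \<exists>b s m. \<forall>\<rho>. m \<le> p1 \<rho> \<longrightarrow> Y \<in> cyl \<rho> \<longrightarrow> accepts e \<rho> (lit c a b) s"
    using copies_element[OF Y(2)] by blast
  \<comment> \<open>The wanted colour exists in every phase: the tag since every board has players,
    a move since each player has one in every round, the mark since the watched element has the
    victim.\<close>
  have "\<exists>a r. new_watched st a \<in> A \<and> wanted n st r \<in> col (new_watched st a)"
  proof (cases "counter st")
    case 0
    obtain a where a: "a \<in> A" "col a = colours X (mk_player n 0 0 0)" using surj by blast
    have "pr 0 n \<in> col a" using tag_in_colours[of "mk_player n 0 0 0" X] a(2) by simp
    then show ?thesis using a(1) 0 by (auto simp: new_watched_def wanted_def)
  next
    case (Suc c)
    then have st: "sound_state n st" unfolding st_def by (rule board_sound)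
    have "Y \<in> cyl (base st)"
    proof -
      have "extends (target n st) (base st)"
        using st Suc by (simp add: target_def sound_state_def extends_refl)
      then show ?thesis using cyl_mono Y(1) by blast
    qed
    then have w: "watched st \<in> A" "pr 0 n \<in> col (watched st)"
      using sound st unfolding sound_state_def e by blast+
    obtain x where x: "col (watched st) = colours X x" using el[OF w(1)] by blast
    have own: "own_board x = n" using w(2) own_board_unique unfolding x by blast
    have "\<exists>r. wanted n st r \<in> colours X x"
    proof (cases "odd (counter st)")
      case True
      then show ?thesis
        using column_in_colours[of x T X] Suc by (simp add: wanted_def own st_def)
    next
      case False
      then have kill: "killing (counter st)" using Suc by (simp add: killing_def)
      then obtain b s where "accepts e (recent st)
          (lit (pr 1 (pr (round_of (counter st)) (victim st))) (watched st) b) s"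
        using st unfolding sound_state_def e by blast
      moreover have "Y \<in> cyl (recent st)" using Y(1) False Suc by (simp add: target_def)
      ultimately have "pr 1 (pr (round_of (counter st)) (victim st)) \<in> colours X x"
        using sound unfolding x[symmetric] by blast
      then have "pr 2 (round_of (counter st)) \<in> colours X x"
        using mark_in_colours[OF own T[folded n_def]] kill unfolding st_def by blast
      then show ?thesis using False Suc by (simp add: wanted_def)
    qed
    then show ?thesis using w(1) Suc x by (auto simp: new_watched_def)
  qed
  then obtain a r where "new_watched st a \<in> A" "wanted n st r \<in> col (new_watched st a)" by blast
  from complete[OF this] obtain b s m where acc: "\<And>\<rho>. m \<le> p1 \<rho> \<Longrightarrow> Y \<in> cyl \<rho> \<Longrightarrow>
      accepts e \<rho> (lit (wanted n st r) (new_watched st a) b) s"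
    by blast
  obtain \<rho> where "m \<le> p1 \<rho>" "Y \<in> cyl \<rho>" "extends \<rho> (target n st)"
    using prefix_extending[OF Y(1)] .
  then have "succeeds n st \<rho> a b s r" using acc by (simp add: succeeds_def e)
  then show False using stall_no_success[OF T[folded n_def]] unfolding st_def by blast
qed

lemma count_at_attained: "c \<le> count_at n t \<Longrightarrow> \<exists>t'. count_at n t' = c"
proof (induction t)
  case 0
  then have "count_at n 0 = c" by (simp add: counter_def)
  then show ?case by blast
next
  case (Suc t)
  have step: "count_at n (Suc t) = count_at n t \<or> count_at n (Suc t) = Suc (count_at n t)"
    using advance_cases[of n "board n t" "p1 t"] by auto
  show ?case
  proof (cases "c \<le> count_at n t")
    case False
    then have "count_at n (Suc t) = c" using step Suc.prems by linarith
    then show ?thesis by blast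
  qed (rule Suc.IH)
qed

text \<open>Typicality bounds the marks of the player owning the watched element, whereas every
  string compatible with \<open>base\<close> has an extension that shows an arbitrarily late
  mark.\<close>

lemma copies_run:
  assumes X: "typical X" and run: "\<And>c. \<exists>t. c \<le> count_at (pr e \<sigma>) t"
    and t1: "count_at (pr e \<sigma>) t1 = Suc 0"
  shows "meagre (cyl (base (board (pr e \<sigma>) t1)) \<inter> copies e (struc_of X))"
proof -
  define n where "n = pr e \<sigma>"
  define \<beta> where "\<beta> = base (board n t1)"
  define a where "a = watched (board n t1)"
  have e: "p1 n = e" by (simp add: n_def)
  have reached: "\<exists>t. count_at n t = c" for c
    using run[of c] count_at_attained unfolding n_def by blast
  define N where "N d = {Y \<in> cyl \<beta>. \<forall>k\<ge>d. \<forall>\<rho> b s. accepts e \<rho> (lit (pr 2 k) a b) s \<longrightarrow> Y \<notin> cyl \<rho>}" for d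
  have "nowhere_dense (N d)" for d
  proof (rule nowhere_denseI)
    fix \<tau>
    show "\<exists>\<rho>. extends \<rho> \<tau> \<and> cyl \<rho> \<inter> N d = {}"
    proof (cases "cyl \<tau> \<inter> cyl \<beta> = {}")
      case True
      then have "cyl \<tau> \<inter> N d = {}" unfolding N_def by blast
      then show ?thesis using extends_refl by blast
    next
      case False
      then obtain Y where Y: "Y \<in> cyl \<tau>" "Y \<in> cyl \<beta>" by blast
      obtain \<tau>' where \<tau>': "p1 \<beta> \<le> p1 \<tau>'" "Y \<in> cyl \<tau>'" "extends \<tau>' \<tau>"
        using prefix_extending[OF Y(1)] .
      then have "extends \<tau>' \<beta>" using extends_if_cyl[OF \<tau>'(2) Y(2) \<tau>'(1)] by simp
      \<comment> \<open>A round to which the string \<open>\<tau>'\<close> is assigned and whose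
        number is at least \<open>d\<close>.\<close>
      define k where "k = pr \<tau>' d"
      have "d \<le> k" by (simp add: k_def le_prod_encode_2)
      obtain t where "count_at n t = Suc (Suc (Suc (2 * k)))" using reached by blast
      then have "\<exists>\<rho> b s. extends \<rho> (p1 k) \<and> accepts (p1 n) \<rho> (lit (pr 2 k) (watched (board n t1)) b) s"
        by (rule mark_reached) (use t1 \<open>extends \<tau>' \<beta>\<close> in \<open>simp_all add: n_def \<beta>_def k_def\<close>)
      then obtain \<rho> b s where \<rho>: "extends \<rho> (p1 k)" "accepts e \<rho> (lit (pr 2 k) a b) s"
        unfolding e a_def[symmetric] by blast
      have "cyl \<rho> \<inter> N d = {}" using \<rho>(2) \<open>d \<le> k\<close> unfolding N_def by blast
      moreover have "extends \<rho> \<tau>" using extends_trans[of \<rho> \<tau>' \<tau>] \<rho>(1) \<tau>'(3) by (simp add: k_def)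
      ultimately show ?thesis by blast
    qed
  qed
  then have "meagre (\<Union>d. N d)" by (intro meagre_UN meagre_nowhere_dense)
  moreover have "cyl \<beta> \<inter> copies e (struc_of X) \<subseteq> (\<Union>d. N d)"
  proof
    fix Y assume "Y \<in> cyl \<beta> \<inter> copies e (struc_of X)"
    then have Y: "Y \<in> cyl \<beta>" "Y \<in> copies e (struc_of X)" by blast+
    obtain A col where el: "\<And>a. a \<in> A \<Longrightarrow> \<exists>x. col a = colours X x"
      and sound: "\<And>\<rho> c a b s. Y \<in> cyl \<rho> \<Longrightarrow> accepts e \<rho> (lit c a b) s \<Longrightarrow> a \<in> A \<and> c \<in> col a"
      by (rule copies_element[OF Y(2)]) blast
    have "sound_state n (board n t1)" using t1 unfolding n_def[symmetric] by (rule board_sound)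
    then have "a \<in> A"
      using sound Y(1) unfolding sound_state_def e \<beta>_def[symmetric] a_def[symmetric] by blast
    from el[OF this] obtain x where x: "col a = colours X x" ..
    obtain d where d: "\<And>j. pr 2 j \<in> colours X x \<Longrightarrow> j < d"
      using marks_in_colours_bounded[OF X] by blast
    have "Y \<notin> cyl \<rho>" if "d \<le> k" "accepts e \<rho> (lit (pr 2 k) a b) s" for k \<rho> b s
    proof
      assume "Y \<in> cyl \<rho>"
      then have "pr 2 k \<in> colours X x" using sound[OF _ that(2)] unfolding x by blast
      then show False using d[of k] that(1) by simp
    qed
    then have "Y \<in> N d" using Y(1) unfolding N_def by blast
    then show "Y \<in> (\<Union>d. N d)" by blast
  qed
  ultimately show ?thesis unfolding \<beta>_def n_def by (rule meagre_subset)
qed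

text \<open>Given \<open>\<sigma>\<close>, the board \<open>(e, \<sigma>)\<close> supplies the
  extension: on its cylinder the set is empty after a stall and meagre otherwise.\<close>

lemma meagre_copies:
  assumes "typical X" shows "meagre (copies e (struc_of X))"
proof (rule meagre_locally)
  fix \<sigma>
  define n where "n = pr e \<sigma>"
  have s: "p2 n = \<sigma>" by (simp add: n_def)
  show "\<exists>\<rho>. extends \<rho> \<sigma> \<and> meagre (cyl \<rho> \<inter> copies e (struc_of X))"
  proof (cases n rule: count_at_dichotomy)
    case (stall T)
    have "cyl (target n (board n T)) \<inter> copies e (struc_of X) = {}"
      using copies_stall[OF stall[unfolded n_def]] by (simp add: n_def)
    moreover have "extends (target n (board n T)) \<sigma>"
    proof (cases "count_at n T")
      case 0
      then show ?thesis by (simp add: target_def s extends_refl)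
    next
      case (Suc c)
      then have st: "sound_state n (board n T)" by (rule board_sound)
      then have "extends (target n (board n T)) (base (board n T))"
        using Suc by (simp add: target_def sound_state_def extends_refl)
      moreover have "extends (base (board n T)) \<sigma>" using st by (simp add: sound_state_def s)
      ultimately show ?thesis by (rule extends_trans)
    qed
    ultimately show ?thesis using meagre_empty by metis
  next
    case run
    obtain t where "1 \<le> count_at n t" using run by blast
    then have "\<exists>t1. count_at n t1 = Suc 0" using count_at_attained[of "Suc 0" n t] by simp
    then obtain t1 where t1: "count_at n t1 = Suc 0" by blast
    have "meagre (cyl (base (board n t1)) \<inter> copies e (struc_of X))"
      using copies_run[OF assms run[unfolded n_def]] t1 by (simp add: n_def)
    moreover have "extends (base (board n t1)) \<sigma>"
      using board_sound[OF t1] by (simp add: sound_state_def s)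
    ultimately show ?thesis by blast
  qed
qed

text \<open>\<open>X\<close> has the same degree as some real that computes a copy, and therefore
  computes the same diagram.\<close>

lemma degree_class_union_spectrum:
  assumes "X \<in> degree_class_union (degree_spectrum lang2 M)"
  shows "\<exists>e. X \<in> copies e M"
proof -
  obtain Z where Z: "turing_degree X = turing_degree Z" "computes_copy lang2 M Z"
    using assms by (auto simp: degree_class_union_def degree_spectrum_def)
  have "Z \<in> turing_degree X" unfolding Z(1) by (simp add: turing_degree_def turing_reducible_refl)
  then have "Z \<le>\<^sub>T X" by (simp add: turing_degree_def)
  obtain N where N: "isomorphic lang2 M N" "atomic_diagram lang2 N \<le>\<^sub>T Z"
    using Z(2) by (auto simp: computes_copy_def)
  have "atomic_diagram lang2 N \<le>\<^sub>T X" by (rule turing_reducible_trans[OF N(2) \<open>Z \<le>\<^sub>T X\<close>])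
  then show ?thesis
    using N(1) unfolding turing_reducible_def computable_from_def copies_def by blast
qed

theorem theorem4p2:
  shows "\<exists>(L :: lang) (M :: nat struc).
    computable_lang L \<and> is_struc L M \<and> countable (universe M) \<and>
    meagre_degrees (degree_spectrum L M) \<and> co_null_degrees (degree_spectrum L M)"
proof -
  \<comment> \<open>Any typical real serves, since all of them build isomorphic structures.\<close>
  obtain X\<^sub>0 where X0: "typical X\<^sub>0" using typical_exists by blast
  let ?M = "struc_of X\<^sub>0"
  have "meagre (\<Union>e. copies e ?M)" using meagre_copies[OF X0] by (rule meagre_UN)
  then have "meagre_degrees (degree_spectrum lang2 ?M)"
    unfolding meagre_degrees_def using degree_class_union_spectrum
    by (elim meagre_subset) blast
  moreover have "co_null_degrees (degree_spectrum lang2 ?M)"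
    unfolding co_null_degrees_def
  proof (rule co_nullI)
    fix X assume "typical X"
    then have "computes_copy lang2 ?M X"
      unfolding computes_copy_def
      using is_struc_struc_of isomorphic_of_typical[OF X0] diagram_reducible by blast
    then show "X \<in> degree_class_union (degree_spectrum lang2 ?M)"
      unfolding degree_class_union_def degree_spectrum_def by blast
  qed
  ultimately show ?thesis
    using computable_lang2 is_struc_struc_of by (intro exI[of _ lang2] exI[of _ ?M]) simp
qed

end
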